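(* There exist an integer $n_0$ and absolute constants $c>0$ and $C>0$ such that for any finite sets $A,B$ of positive real numbers with $|A|=|B|\geq n_0$, $$|AB+A| \geq C\,|A|^{\frac{3}{2}+c},$$ where $AB+A=\{ab+a' : a,a'\in A,\ b\in B\}$.
   Context: For finite sets $A,B\subset\mathbb{R}$, $AB+A:=\{ab+a': a,a'\in A, b\in B\}$. The paper writes the conclusion as $|AB+A|\gg |A|^{3/2+c}$, where $\gg$ hides an absolute positive constant. *)

theory Defs
  imports Complex_Main
begin

end

theory Submission
  imports Defs "HOL-Analysis.Convex"
begin

text \<open>Write \<open>n\<close> for \<open>|A|\<close> and \<open>D\<close> for \<open>AB + A\<close>. Following Solymosi and Balog, order the lines through the origin that
  meet \<open>A \<times> A\<close> by slope. If \<open>P_s\<close> is the set of points on the line of slope \<open>s\<close> and \<open>p_t\<close> one point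
  on the line of slope \<open>t\<close>, then \<open>P_s + B p_t\<close> lies in \<open>D \<times> D\<close>, strictly between both lines.
  Consecutive lines give \<open>|D|\<^sup>2 \<ge> n\<^sup>3\<close>. To gain a power of \<open>n\<close>, restrict to slopes with
  \<open>|P_s|\<close> about \<open>N\<close>, cut them into clusters of \<open>2 M\<close> consecutive slopes and use all \<open>M\<^sup>2\<close> pairs
  inside a cluster (Konyagin and Shkredov): this wins unless the sums within a cluster collide often.

  Collisions with different \<open>t\<close> are determined by a pair of points, or else are incidences between
  lines and a Cartesian product. Collisions with equal \<open>t\<close> are rare for small \<open>N\<close> since two slopes
  and two points determine \<open>t\<close>. For large \<open>N\<close>, consecutive lines already force
  \<open>|B X| \<le> n\<^sup>1\<^sup>+\<^sup>\<epsilon>\<close> for some \<open>X \<subseteq> A\<close> with \<open>|X| = N\<close>, so by Szemeredi--Trotter few differences of \<open>B\<close>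
  are popular, and a second application of Szemeredi--Trotter shows that few collisions use a popular difference.
  The two ranges of \<open>N\<close> overlap, with \<open>M\<close> about \<open>n\<^sup>1\<^sup>/\<^sup>2\<close> in the first and \<open>n\<^sup>0\<^sup>.\<^sup>3\<^sup>1\<close> in the second.\<close>

section \<open>Incidences with Cartesian products\<close>

text \<open>Dividing the rank \<open>card {y \<in> P. y < x}\<close> by \<open>w\<close> numbers the
  blocks; the rank is injective on \<open>P\<close>, so at most \<open>w\<close> of its elements
  share a number. Numbering all reals makes monotonicity available at arbitrary arguments.\<close>

lemma rank_blocks:
  fixes P :: "real set"
  assumes "finite P" "w > 0"
  obtains f :: "real \<Rightarrow> nat"
    where "\<And>x y. x \<le> y \<Longrightarrow> f x \<le> f y"
      and "\<And>x. f x \<le> card P div w"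
      and "\<And>i. card {x \<in> P. f x = i} \<le> w"
proof -
  define r where "r x = card {y \<in> P. y < x}" for x
  have r_mono: "r x \<le> r y" if "x \<le> y" for x y
    unfolding r_def using that assms by (intro card_mono) auto
  have r_less: "r x < r y" if "x < y" "x \<in> P" for x y
    unfolding r_def using that assms by (intro psubset_card_mono) auto
  have r_inj: "inj_on r P"
    by (metis inj_onI less_irrefl linorder_less_linear r_less)
  show thesis
  proof (rule that[of "\<lambda>x. r x div w"])
    fix x y :: real assume "x \<le> y"
    then show "r x div w \<le> r y div w" by (intro div_le_mono r_mono)
  next
    fix x
    have "r x \<le> card P" unfolding r_def using assms by (intro card_mono) auto
    then show "r x div w \<le> card P div w" by (rule div_le_mono)
  next
    fix i
    have sub: "r ` {x \<in> P. r x div w = i} \<subseteq> {i * w..<i * w + w}"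
      using assms(2) by (auto simp: dividend_less_div_times add.commute[of _ w])
    have "card {x \<in> P. r x div w = i} = card (r ` {x \<in> P. r x div w = i})"
      by (metis (no_types, lifting) card_image inj_on_subset mem_Collect_eq r_inj subsetI)
    also have "\<dots> \<le> card {i * w..<i * w + w}" by (intro card_mono sub) auto
    finally show "card {x \<in> P. r x div w = i} \<le> w" by simp
  qed
qed

text \<open>Pick one representative in each fibre of \<open>f\<close>; every other element of
  \<open>X\<close> collides with its representative.\<close>

lemma card_le_card_image_plus_collisions:
  assumes "finite X"
  shows "card X \<le> card (f ` X) + card {(x, x'). x \<in> X \<and> x' \<in> X \<and> x \<noteq> x' \<and> f x = f x'}"
    (is "_ \<le> _ + card ?C")
proof -
  define g where "g x = inv_into X f (f x)" for x
  have g: "g x \<in> X" "f (g x) = f x" if "x \<in> X" for x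
    using that by (auto simp: g_def inv_into_into f_inv_into_f)
  let ?R = "g ` X"
  have finC: "finite ?C"
    by (rule finite_subset[of _ "X \<times> X"]) (use assms in auto)
  have "card ?R = card (inv_into X f ` (f ` X))" by (simp add: g_def image_image)
  also have "\<dots> \<le> card (f ` X)" by (intro card_image_le) (use assms in auto)
  finally have R: "card ?R \<le> card (f ` X)" .
  have gR: "g x = x" if "x \<in> ?R" for x
    using that by (auto simp: g_def f_inv_into_f)
  have "card (X - ?R) \<le> card ?C"
  proof (rule card_inj_on_le[where f = "\<lambda>x. (x, g x)"])
    show "(\<lambda>x. (x, g x)) ` (X - ?R) \<subseteq> ?C"
    proof (safe)
      fix x assume x: "x \<in> X" "x \<notin> ?R"
      then show "g x \<in> X" "f x = f (g x)" using g by auto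
      assume "x = g x" then show False using x by blast
    qed
  qed (auto simp: inj_on_def finC)
  moreover have "card X = card ?R + card (X - ?R)"
    by (metis Diff_partition assms card_Un_disjoint finite_Diff finite_imageI g(1) image_subsetI Diff_disjoint)
  ultimately show ?thesis using R by linarith
qed

text \<open>A line is monotone, so the cells it visits form a monotone staircase. On a staircase a
  cell is determined by its antidiagonal (or diagonal), and there are \<open>a + b + 1\<close> of
  these.\<close>

lemma card_line_blocks_le:
  fixes X :: "real set" and f g :: "real \<Rightarrow> nat"
  assumes f: "\<And>x y. x \<le> y \<Longrightarrow> f x \<le> f y" "\<And>x. f x \<le> a"
    and g: "\<And>x y. x \<le> y \<Longrightarrow> g x \<le> g y" "\<And>x. g x \<le> b"
  shows "card ((\<lambda>x. (f x, g (m * x + c))) ` X) \<le> a + b + 1"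
proof -
  let ?F = "\<lambda>x. (f x, g (m * x + c))"
  \<comment> \<open>For negative slope the second index is reversed; \<open>b - j\<close> does not
    truncate because \<open>g\<close> is bounded by \<open>b\<close>.\<close>
  define h where "h = (\<lambda>(i, j). if m \<ge> 0 then i + j else i + (b - j))"
  have key: "?F x = ?F y" if "x \<le> y" "h (?F x) = h (?F y)" for x y
  proof (cases "m \<ge> 0")
    case True
    then have "g (m * x + c) \<le> g (m * y + c)" using that by (intro g) (auto intro: mult_left_mono)
    with f(1)[OF that(1)] that(2) True show ?thesis by (auto simp: h_def)
  next
    case False
    then have "g (m * y + c) \<le> g (m * x + c)" using that
      by (intro g) (auto intro: mult_left_mono_neg)
    moreover have "g (m * x + c) \<le> b" by (rule g)
    ultimately show ?thesis using f(1)[OF that(1)] that(2) False by (auto simp: h_def)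
  qed
  have "inj_on h (?F ` X)"
  proof (rule inj_onI)
    fix u v assume "u \<in> ?F ` X" "v \<in> ?F ` X" and huv: "h u = h v"
    then obtain x y where u: "u = ?F x" "v = ?F y" by auto
    then show "u = v" using key[of x y] key[of y x] huv by (cases "x \<le> y") auto
  qed
  moreover have "h ` ?F ` X \<subseteq> {..a + b}"
  proof safe
    fix x
    show "h (?F x) \<le> a + b" using f(2)[of x] g(2)[of "m * x + c"] by (auto simp: h_def)
  qed
  ultimately have "card (?F ` X) \<le> card {..a + b}"
    by (metis card_inj_on_le finite_atMost)
  then show ?thesis by simp
qed

text \<open>The Szemeredi--Trotter theorem for points in a Cartesian product: cut both factors into
  blocks of consecutive elements. A line meets few cells of the resulting grid, and each pair of
  points in a common cell lies on at most one line. Optimising the block lengths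
  \<open>w1\<close>, \<open>w2\<close> gives the usual exponents.\<close>

lemma grid_incidences_le:
  fixes P Q :: "real set" and L :: "(real \<times> real) set"
  assumes fin: "finite P" "finite Q" "finite L" and w: "w1 > 0" "w2 > 0"
  shows "(\<Sum>(m, c)\<in>L. card {x \<in> P. m * x + c \<in> Q})
    \<le> card L * (card P div w1 + card Q div w2 + 1) + card P * card Q * w1 * w2"
proof -
  obtain f where f: "\<And>x y. x \<le> y \<Longrightarrow> f x \<le> f y" "\<And>x. f x \<le> card P div w1"
    "\<And>i. card {x \<in> P. f x = i} \<le> w1"
    using rank_blocks[OF fin(1) w(1)] by metis
  obtain g where g: "\<And>x y. x \<le> y \<Longrightarrow> g x \<le> g y" "\<And>x. g x \<le> card Q div w2"
    "\<And>i. card {x \<in> Q. g x = i} \<le> w2"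
    using rank_blocks[OF fin(2) w(2)] by metis
  define X where "X l = {x \<in> P. fst l * x + snd l \<in> Q}" for l
  define F where "F l x = (f x, g (fst l * x + snd l))" for l x
  define C where "C l = {(x, x'). x \<in> X l \<and> x' \<in> X l \<and> x \<noteq> x' \<and> F l x = F l x'}" for l
  have finX: "finite (X l)" for l using fin by (auto simp: X_def)
  have finC: "finite (C l)" for l
    by (rule finite_subset[of _ "X l \<times> X l"]) (use finX in \<open>auto simp: C_def\<close>)
  have 1: "card (X l) \<le> (card P div w1 + card Q div w2 + 1) + card (C l)" for l
  proof -
    have "card (X l) \<le> card (F l ` X l) + card (C l)"
      unfolding C_def by (rule card_le_card_image_plus_collisions[OF finX])
    moreover have "card (F l ` X l) \<le> card P div w1 + card Q div w2 + 1"
      unfolding F_def by (intro card_line_blocks_le f g)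
    ultimately show ?thesis by linarith
  qed
  \<comment> \<open>Each of the \<open>card P * card Q\<close> points has at most
    \<open>w1 * w2\<close> companions in its cell, which bounds the pairs collected in
    \<open>Z\<close>.\<close>
  define Z where "Z = (SIGMA p:P \<times> Q. {x \<in> P. f x = f (fst p)} \<times> {y \<in> Q. g y = g (snd p)})"
  have finZ: "finite Z" unfolding Z_def using fin by (intro finite_SigmaI) auto
  have "card Z = (\<Sum>p\<in>P \<times> Q. card {x \<in> P. f x = f (fst p)} * card {y \<in> Q. g y = g (snd p)})"
    unfolding Z_def using fin by (subst card_SigmaI) (auto simp: card_cartesian_product)
  also have "\<dots> \<le> (\<Sum>p\<in>P \<times> Q. w1 * w2)"
    by (intro sum_mono mult_le_mono f g)
  finally have cZ: "card Z \<le> card P * card Q * w1 * w2"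
    by (simp add: card_cartesian_product)
  have "(\<Sum>l\<in>L. card (C l)) = card (Sigma L C)"
    using fin finC by (subst card_SigmaI) auto
  \<comment> \<open>Two points with different abscissae determine \<open>m\<close> and
    \<open>c\<close>, so the pair of points remembers its line.\<close>
  also have "\<dots> \<le> card Z"
  proof (rule card_inj_on_le[where
        f = "\<lambda>(l, x, x'). ((x, fst l * x + snd l), (x', fst l * x' + snd l))"])
    show "inj_on (\<lambda>(l, x, x'). ((x, fst l * x + snd l), (x', fst l * x' + snd l))) (Sigma L C)"
    proof (rule inj_onI, clarsimp simp: C_def)
      fix m c m' c' x x' :: real
      assume ne: "x \<noteq> x'" and e: "m * x + c = m' * x + c'" "m * x' + c = m' * x' + c'"
      then have "(m - m') * (x - x') = 0" by (simp add: algebra_simps)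
      with ne have "m = m'" by simp
      with e show "m = m' \<and> c = c'" by simp
    qed
    show "(\<lambda>(l, x, x'). ((x, fst l * x + snd l), (x', fst l * x' + snd l))) ` Sigma L C \<subseteq> Z"
      by (auto simp: Z_def C_def X_def F_def)
  qed (rule finZ)
  finally have 2: "(\<Sum>l\<in>L. card (C l)) \<le> card P * card Q * w1 * w2" using cZ by linarith
  have "(\<Sum>(m, c)\<in>L. card {x \<in> P. m * x + c \<in> Q}) = (\<Sum>l\<in>L. card (X l))"
    by (simp add: X_def case_prod_unfold)
  also have "\<dots> \<le> (\<Sum>l\<in>L. (card P div w1 + card Q div w2 + 1) + card (C l))"
    by (intro sum_mono 1)
  also have "\<dots> = card L * (card P div w1 + card Q div w2 + 1) + (\<Sum>l\<in>L. card (C l))"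
    by (simp only: sum.distrib sum_constant of_nat_id distrib_left)
  finally show ?thesis using 2 by linarith
qed

section \<open>Popular differences and affine relations when a product set is small\<close>

text \<open>If \<open>b - b' = d\<close>, the line \<open>z \<mapsto> x * (z + d)\<close> passes
  through \<open>(b', x * b)\<close>. So the lines indexed by \<open>X \<times> R\<close>, distinct
  because \<open>0 \<notin> X\<close>, all contain at least \<open>\<tau>\<close> points of the grid
  formed by \<open>B\<close> and the product set.\<close>

lemma card_eq_mult_popular_differences_le:
  fixes B X R :: "real set"
  assumes fin: "finite B" "finite X" "finite R" and X: "0 \<notin> X" and w: "w1 > 0" "w2 > 0"
    and R: "\<And>d. d \<in> R \<Longrightarrow> \<tau> \<le> real (card {(b, b'). b \<in> B \<and> b' \<in> B \<and> b - b' = d})"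
    and Y: "card {x * b | x b. x \<in> X \<and> b \<in> B} \<le> Y"
  shows "real (card X * card R) * \<tau> \<le>
    real (card X * card R * (card B div w1 + Y div w2 + 1) + card B * Y * w1 * w2)"
proof -
  define Q where "Q = {x * b | x b. x \<in> X \<and> b \<in> B}"
  have Q: "Q = (\<lambda>(x, b). x * b) ` (X \<times> B)" by (auto simp: Q_def)
  have finQ: "finite Q" unfolding Q using fin by auto
  define l where "l = (\<lambda>(x :: real, d). (x, x * d))"
  have inj: "inj_on l (X \<times> R)" using X by (auto simp: inj_on_def l_def)
  have cL: "card (l ` (X \<times> R)) = card X * card R"
    using inj by (simp add: card_image card_cartesian_product)
  have rich: "\<tau> \<le> real (card {z \<in> B. x * z + x * d \<in> Q})" if "x \<in> X" "d \<in> R" for x d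
  proof -
    have "card {(b, b'). b \<in> B \<and> b' \<in> B \<and> b - b' = d} \<le> card {z \<in> B. x * z + x * d \<in> Q}"
    proof (rule card_inj_on_le[where f = snd])
      show "snd ` {(b, b'). b \<in> B \<and> b' \<in> B \<and> b - b' = d} \<subseteq> {z \<in> B. x * z + x * d \<in> Q}"
      proof safe
        fix b b' assume b: "b \<in> B" "d = b - b'"
        have "x * b' + x * d = x * b" by (simp add: b algebra_simps)
        then show "x * snd (b, b') + x * (b - b') \<in> Q" using that b by (auto simp: Q_def)
      qed auto
    qed (use fin in \<open>auto simp: inj_on_def\<close>)
    with R[OF that(2)] show ?thesis by linarith
  qed
  have "real (card X * card R) * \<tau> = (\<Sum>p\<in>X \<times> R. \<tau>)"
    by (simp add: card_cartesian_product)
  also have "\<dots> \<le> (\<Sum>p\<in>X \<times> R. real (card {z \<in> B. fst p * z + fst p * snd p \<in> Q}))"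
    by (intro sum_mono rich) auto
  also have "\<dots> = real (\<Sum>(m, c)\<in>l ` (X \<times> R). card {z \<in> B. m * z + c \<in> Q})"
    by (subst sum.reindex[OF inj]) (simp add: l_def case_prod_unfold)
  also have "\<dots> \<le> real (card (l ` (X \<times> R)) * (card B div w1 + card Q div w2 + 1) + card B * card Q * w1 * w2)"
    by (intro of_nat_mono grid_incidences_le) (use fin finQ w in auto)
  also have "\<dots> \<le> real (card X * card R * (card B div w1 + Y div w2 + 1) + card B * Y * w1 * w2)"
    unfolding cL using Y
    by (intro of_nat_mono add_mono mult_le_mono div_le_mono) (auto simp: Q_def)
  finally show ?thesis .
qed

text \<open>Multiplying the relation by any \<open>x \<in> X\<close> puts
  \<open>x * (\<beta> * a' - \<alpha> * a)\<close> into the product set. Every pair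
  \<open>(a, a')\<close> therefore yields \<open>card X\<close> incidences, one with each line of
  slope \<open>x * \<beta>\<close> and intercept \<open>- (x * \<alpha> * a)\<close>.\<close>

lemma card_mult_affine_pairs_le:
  fixes B X U V :: "real set"
  assumes fin: "finite B" "finite X" "finite U" "finite V" and X: "0 \<notin> X" and w: "w1 > 0" "w2 > 0"
    and nz: "\<alpha> \<noteq> 0" "\<beta> \<noteq> 0"
    and Y: "card {x * b | x b. x \<in> X \<and> b \<in> B} \<le> Y"
  shows "card X * card {(a, a'). a \<in> U \<and> a' \<in> V \<and> \<beta> * a' - \<alpha> * a \<in> B} \<le>
    card X * card U * (card V div w1 + Y div w2 + 1) + card V * Y * w1 * w2"
proof -
  define Q where "Q = {x * b | x b. x \<in> X \<and> b \<in> B}"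
  have Q: "Q = (\<lambda>(x, b). x * b) ` (X \<times> B)" by (auto simp: Q_def)
  have finQ: "finite Q" unfolding Q using fin by auto
  define l where "l = (\<lambda>(x, a). (x * \<beta>, - (x * \<alpha> * a)))"
  have inj: "inj_on l (X \<times> U)" using X nz by (auto simp: inj_on_def l_def)
  have cL: "card (l ` (X \<times> U)) = card X * card U"
    using inj by (simp add: card_image card_cartesian_product)
  define E where "E a = {a' \<in> V. \<beta> * a' - \<alpha> * a \<in> B}" for a
  have finE: "finite (E a)" for a using fin by (simp add: E_def)
  have "{(a, a'). a \<in> U \<and> a' \<in> V \<and> \<beta> * a' - \<alpha> * a \<in> B} = Sigma U E" by (auto simp: E_def)
  then have "card X * card {(a, a'). a \<in> U \<and> a' \<in> V \<and> \<beta> * a' - \<alpha> * a \<in> B}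
      = (\<Sum>x\<in>X. \<Sum>a\<in>U. card (E a))" using fin finE by simp
  also have "\<dots> = (\<Sum>p\<in>X \<times> U. card (E (snd p)))"
    by (simp only: sum.cartesian_product case_prod_unfold)
  also have "\<dots> \<le> (\<Sum>p\<in>X \<times> U. card {z \<in> V. fst (l p) * z + snd (l p) \<in> Q})"
  proof (intro sum_mono card_mono)
    fix p assume "p \<in> X \<times> U"
    then show "E (snd p) \<subseteq> {z \<in> V. fst (l p) * z + snd (l p) \<in> Q}"
      by (auto simp: E_def Q_def l_def) (metis mult.assoc right_diff_distrib)
  qed (use fin in auto)
  also have "\<dots> = (\<Sum>(m, c)\<in>l ` (X \<times> U). card {z \<in> V. m * z + c \<in> Q})"
    by (subst sum.reindex[OF inj]) (simp add: case_prod_unfold)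
  also have "\<dots> \<le> card (l ` (X \<times> U)) * (card V div w1 + card Q div w2 + 1) + card V * card Q * w1 * w2"
    by (intro grid_incidences_le) (use fin finQ w in auto)
  also have "\<dots> \<le> card X * card U * (card V div w1 + Y div w2 + 1) + card V * Y * w1 * w2"
    unfolding cL using Y
    by (intro add_mono mult_le_mono div_le_mono) (auto simp: Q_def)
  finally show ?thesis .
qed

section \<open>Collisions inside a cluster of slopes\<close>

text \<open>Cauchy--Schwarz applied to the sizes of the fibres of \<open>f\<close>.\<close>

lemma card_squared_le_card_image_mult_collisions:
  assumes "finite I"
  shows "(card I)\<^sup>2 \<le> card (f ` I) * card {(i, j). i \<in> I \<and> j \<in> I \<and> f i = f j}"
proof -
  define c where "c z = card {i \<in> I. f i = z}" for z
  have cI: "card I = (\<Sum>z\<in>f ` I. c z)"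
  proof -
    have "(\<Sum>z\<in>f ` I. \<Sum>i\<in>{i \<in> I. f i = z}. (1::nat)) = (\<Sum>i\<in>I. 1)"
      using assms by (intro sum.group) auto
    then show ?thesis by (simp add: c_def)
  qed
  have "{(i, j). i \<in> I \<and> j \<in> I \<and> f i = f j}
      = (\<Union>z\<in>f ` I. {i \<in> I. f i = z} \<times> {i \<in> I. f i = z})" by auto
  also have "card \<dots> = (\<Sum>z\<in>f ` I. c z * c z)"
    using assms by (subst card_UN_disjoint) (auto simp: c_def card_cartesian_product)
  finally have e: "card {(i, j). i \<in> I \<and> j \<in> I \<and> f i = f j} = (\<Sum>z\<in>f ` I. c z * c z)" .
  have "(\<Sum>z\<in>f ` I. real (c z))\<^sup>2 \<le> (\<Sum>z\<in>f ` I. (real (c z))\<^sup>2) * real (card (f ` I))"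
    by (rule sum_squared_le_sum_of_squares)
  then have "real ((card I)\<^sup>2) \<le> real (card (f ` I) * (\<Sum>z\<in>f ` I. c z * c z))"
    by (simp add: cI power2_eq_square mult.commute)
  then show ?thesis unfolding e by (simp only: of_nat_le_iff)
qed

text \<open>\<open>C1\<close> holds the lower slopes of the cluster and \<open>C2\<close> the upper
  ones, \<open>X s\<close> the abscissae of the points on the line of slope \<open>s\<close>;
  \<open>\<eta> t\<close> is the abscissa of the single point \<open>p_t\<close> picked on the line
  of slope \<open>t\<close>.\<close>

locale cluster =
  fixes C1 C2 B :: "real set" and X :: "real \<Rightarrow> real set" and \<eta> :: "real \<Rightarrow> real"
    and M N n :: nat
  assumes card_C1: "card C1 = M" and card_C2: "card C2 = M" and M_pos: "M > 0"
    and C12: "\<And>s t. s \<in> C1 \<Longrightarrow> t \<in> C2 \<Longrightarrow> s < t"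
    and finite_B: "finite B" and card_B: "card B = n" and n_pos: "n > 0"
    and finite_X: "\<And>s. s \<in> C1 \<Longrightarrow> finite (X s)" and card_X: "\<And>s. s \<in> C1 \<Longrightarrow> card (X s) = N"
    and N_pos: "N > 0"
    and X_pos: "\<And>s a. s \<in> C1 \<Longrightarrow> a \<in> X s \<Longrightarrow> a > 0"
    and \<eta>_pos: "\<And>t. t \<in> C2 \<Longrightarrow> \<eta> t > 0"
begin

lemma finite_C: "finite C1" "finite C2"
  using card_C1 card_C2 M_pos card_ge_0_finite by metis+

text \<open>The pair \<open>(s, a)\<close> stands for the point \<open>(a, s a)\<close> on the line of slope \<open>s\<close>.\<close>

definition pts :: "(real \<times> real) set" where "pts = Sigma C1 X"

text \<open>The vector \<open>(a, s a)\<close> plus \<open>b\<close> times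
  \<open>p_t = (\<eta> t, t \<eta> t)\<close>.\<close>

definition vec_sum :: "(real \<times> real) \<times> real \<times> real \<Rightarrow> real \<times> real" where
  "vec_sum = (\<lambda>((s, a), t, b). (a + b * \<eta> t, s * a + b * (t * \<eta> t)))"

definition sumset :: "(real \<times> real) set" where "sumset = vec_sum ` (pts \<times> C2 \<times> B)"

definition collisions where
  "collisions = {(i, j). i \<in> pts \<times> C2 \<times> B \<and> j \<in> pts \<times> C2 \<times> B \<and> vec_sum i = vec_sum j}"

text \<open>Rearranged from \<open>s a - s' a' = t (a - a')\<close>: the difference of the two
  points is a multiple of \<open>(1, t)\<close>, as every collision with equal \<open>t\<close>
  forces.\<close>

definition parallel :: "real \<Rightarrow> ((real \<times> real) \<times> real \<times> real) set" where
  "parallel t = {(p, p'). p \<in> pts \<and> p' \<in> pts \<and> snd p * (fst p - t) = snd p' * (fst p' - t)}"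

definition reps :: "real \<Rightarrow> nat" where
  "reps d = card {(b, b'). b \<in> B \<and> b' \<in> B \<and> b - b' = d}"

text \<open>For \<open>t \<noteq> t'\<close> the two coordinates of a collision can be solved for
  \<open>b\<close>, which gives this affine form in \<open>a\<close> and \<open>a'\<close>.\<close>

definition cross :: "real \<times> real \<times> real \<times> real \<Rightarrow> (real \<times> real) set" where
  "cross = (\<lambda>(s, s', t, t'). {(a, a'). a \<in> X s \<and> a' \<in> X s' \<and>
     (s' - t') / (\<eta> t * (t - t')) * a' - (s - t') / (\<eta> t * (t - t')) * a \<in> B})"

definition quads :: "(real \<times> real \<times> real \<times> real) set" where
  "quads = {(s, s', t, t'). s \<in> C1 \<and> s' \<in> C1 \<and> t \<in> C2 \<and> t' \<in> C2 \<and> t \<noteq> t'}"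

lemma finite_pts: "finite pts" and card_pts: "card pts = M * N"
  using finite_C finite_X card_C1 card_X by (auto simp: pts_def)

lemma pts_pos: "p \<in> pts \<Longrightarrow> snd p > 0"
  using X_pos by (auto simp: pts_def)

lemma finite_parallel: "finite (parallel t)"
  by (rule finite_subset[of _ "pts \<times> pts"]) (auto simp: parallel_def finite_pts)

lemma finite_quads: "finite quads" and card_quads_le: "card quads \<le> M ^ 4"
proof -
  have s: "quads \<subseteq> C1 \<times> C1 \<times> C2 \<times> C2" by (auto simp: quads_def)
  show "finite quads" by (rule finite_subset[OF s]) (use finite_C in auto)
  have "card quads \<le> card (C1 \<times> C1 \<times> C2 \<times> C2)" by (intro card_mono s) (use finite_C in auto)
  then show "card quads \<le> M ^ 4"
    by (simp add: card_cartesian_product card_C1 card_C2 power4_eq_xxxx mult.assoc)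
qed

lemma finite_cross: "q \<in> quads \<Longrightarrow> finite (cross q)"
  by (rule finite_subset[of _ "X (fst q) \<times> X (fst (snd q))"])
    (auto simp: cross_def quads_def finite_X)

section \<open>Counting collisions\<close>

text \<open>Subtracting \<open>t\<close> times the first coordinate from the second eliminates both
  multiples of \<open>p_t\<close>.\<close>

lemma collision_same:
  assumes e: "vec_sum ((s, a), t, b) = vec_sum ((s', a'), t, b')" and t: "t \<in> C2"
  shows "a * (s - t) = a' * (s' - t)" "b - b' = (a' - a) / \<eta> t"
proof -
  have 1: "a + b * \<eta> t = a' + b' * \<eta> t" and 2: "s * a + b * (t * \<eta> t) = s' * a' + b' * (t * \<eta> t)"
    using e by (auto simp: vec_sum_def)
  have "t * (a + b * \<eta> t) = t * (a' + b' * \<eta> t)" using 1 by simp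
  with 2 show "a * (s - t) = a' * (s' - t)" by (simp add: algebra_simps)
  show "b - b' = (a' - a) / \<eta> t" using 1 \<eta>_pos[OF t] by (simp add: field_simps)
qed

text \<open>Subtracting \<open>t'\<close> times the first coordinate from the second eliminates
  \<open>b'\<close>; the first coordinate then returns \<open>b'\<close>.\<close>

lemma collision_cross:
  assumes e: "vec_sum ((s, a), t, b) = vec_sum ((s', a'), t', b')"
    and t: "t \<in> C2" "t' \<in> C2" "t \<noteq> t'"
  shows "b = (s' - t') / (\<eta> t * (t - t')) * a' - (s - t') / (\<eta> t * (t - t')) * a"
    "b' = (a + b * \<eta> t - a') / \<eta> t'"
proof -
  have 1: "a + b * \<eta> t = a' + b' * \<eta> t'" and 2: "s * a + b * (t * \<eta> t) = s' * a' + b' * (t' * \<eta> t')"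
    using e by (auto simp: vec_sum_def)
  have "t' * (a + b * \<eta> t) = t' * (a' + b' * \<eta> t')" using 1 by simp
  with 2 have "b * (\<eta> t * (t - t')) = (s' - t') * a' - (s - t') * a" by (simp add: algebra_simps)
  moreover have "\<eta> t * (t - t') \<noteq> 0" using t \<eta>_pos[OF t(1)] by simp
  ultimately have "b = ((s' - t') * a' - (s - t') * a) / (\<eta> t * (t - t'))"
    by (metis nonzero_mult_div_cancel_right)
  then show "b = (s' - t') / (\<eta> t * (t - t')) * a' - (s - t') / (\<eta> t * (t - t')) * a"
    by (simp only: diff_divide_distrib[of "(s' - t') * a'"] times_divide_eq_left)
  show "b' = (a + b * \<eta> t - a') / \<eta> t'" using 1 \<eta>_pos[OF t(2)] by (simp add: field_simps)
qed

text \<open>A collision with equal \<open>t\<close> consists of a parallel pair and a representation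
  of a prescribed difference of \<open>B\<close>. In any other collision four slopes and two
  abscissae determine \<open>b\<close> and \<open>b'\<close>.\<close>

lemma card_collisions_le:
  "card collisions \<le> (\<Sum>t\<in>C2. \<Sum>(p, p')\<in>parallel t. reps ((snd p' - snd p) / \<eta> t))
     + (\<Sum>q\<in>quads. card (cross q))"
proof -
  define K1 where "K1 = {(i, j) \<in> collisions. fst (snd i) = fst (snd j)}"
  define K2 where "K2 = {(i, j) \<in> collisions. fst (snd i) \<noteq> fst (snd j)}"
  have U: "collisions = K1 \<union> K2" by (auto simp: K1_def K2_def)
  define G where "G = (\<lambda>(t, p :: real \<times> real, p' :: real \<times> real). {(b, b'). b \<in> B \<and> b' \<in> B \<and> b - b' = (snd p' - snd p) / \<eta> t})"
  have finG: "finite (G u)" for u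
    by (rule finite_subset[of _ "B \<times> B"]) (use finite_B in \<open>auto simp: G_def\<close>)
  have "card K1 \<le> card (Sigma (Sigma C2 parallel) G)"
  proof (rule card_inj_on_le[where f = "\<lambda>((p, t, b), (p', t', b')). ((t, p, p'), (b, b'))"])
    show "inj_on (\<lambda>((p, t, b), (p', t', b')). ((t, p, p'), (b, b'))) K1"
      by (rule inj_onI) (clarsimp simp: K1_def)
    show "(\<lambda>((p, t, b), (p', t', b')). ((t, p, p'), (b, b'))) ` K1 \<subseteq> Sigma (Sigma C2 parallel) G"
    proof (clarsimp simp: K1_def collisions_def)
      fix s a t b s' a' b'
      assume "(s, a) \<in> pts" "(s', a') \<in> pts" "t \<in> C2" "b \<in> B" "b' \<in> B"
        and e: "vec_sum ((s, a), t, b) = vec_sum ((s', a'), t, b')"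
      with collision_same[OF e]
      show "((s, a), s', a') \<in> parallel t \<and> (b, b') \<in> G (t, (s, a), s', a')"
        by (simp add: parallel_def G_def)
    qed
    show "finite (Sigma (Sigma C2 parallel) G)"
      using finite_C finite_parallel finG by auto
  qed
  also have "\<dots> = (\<Sum>u\<in>Sigma C2 parallel. card (G u))"
    using finite_C finite_parallel finG by simp
  also have "\<dots> = (\<Sum>(t, q)\<in>Sigma C2 parallel. case q of (p, p') \<Rightarrow> reps ((snd p' - snd p) / \<eta> t))"
    by (rule sum.cong) (auto simp: G_def reps_def)
  also have "\<dots> = (\<Sum>t\<in>C2. \<Sum>(p, p')\<in>parallel t. reps ((snd p' - snd p) / \<eta> t))"
    by (rule sum.Sigma[symmetric]) (use finite_C finite_parallel in auto)
  finally have 1: "card K1 \<le> \<dots>" .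
  have "card K2 \<le> card (Sigma quads cross)"
  proof (rule card_inj_on_le[where f = "\<lambda>(((s, a), t, b), ((s', a'), t', b')). ((s, s', t, t'), (a, a'))"])
    show "inj_on (\<lambda>(((s, a), t, b), ((s', a'), t', b')). ((s, s', t, t'), (a, a'))) K2"
    proof (rule inj_onI, clarsimp simp: K2_def collisions_def)
      fix s a t b s' a' t' b' c c'
      assume t: "t \<in> C2" "t' \<in> C2" "t \<noteq> t'"
        and e: "vec_sum ((s, a), t, b) = vec_sum ((s', a'), t', b')"
          "vec_sum ((s, a), t, c) = vec_sum ((s', a'), t', c')"
      have "b = c" using collision_cross(1)[OF e(1) t] collision_cross(1)[OF e(2) t] by simp
      then show "b = c \<and> b' = c'"
        using collision_cross(2)[OF e(1) t] collision_cross(2)[OF e(2) t] by simp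
    qed
    show "(\<lambda>(((s, a), t, b), ((s', a'), t', b')). ((s, s', t, t'), (a, a'))) ` K2 \<subseteq> Sigma quads cross"
    proof (clarsimp simp: K2_def collisions_def)
      fix s a t b s' a' t' b'
      assume p: "(s, a) \<in> pts" "(s', a') \<in> pts" and t: "t \<in> C2" "t' \<in> C2" "t \<noteq> t'" and b: "b \<in> B"
        and e: "vec_sum ((s, a), t, b) = vec_sum ((s', a'), t', b')"
      show "(s, s', t, t') \<in> quads \<and> (a, a') \<in> cross (s, s', t, t')"
        using p t b[unfolded collision_cross(1)[OF e t]]
        by (simp add: pts_def quads_def cross_def)
    qed
    show "finite (Sigma quads cross)" using finite_quads finite_cross by auto
  qed
  also have "\<dots> = (\<Sum>q\<in>quads. card (cross q))"
    using finite_quads finite_cross by simp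
  finally have 2: "card K2 \<le> \<dots>" .
  have "card collisions \<le> card K1 + card K2" unfolding U by (rule card_Un_le)
  with 1 2 show ?thesis by linarith
qed

text \<open>There are \<open>M^2 N n\<close> sums counted with multiplicity, so Cauchy--Schwarz
  converts the collision bound into the claim. Consecutive lines of the cluster would give only the
  order \<open>M N n\<close>, so \<open>K\<close> measures the gain.\<close>

lemma card_sumset_ge:
  assumes K: "K > 0" and c: "real (card collisions) * K \<le> real M ^ 3 * real N * real n"
  shows "real M * real N * real n * K \<le> real (card sumset)"
proof -
  define T where "T = real M * real N * real n"
  have T: "T > 0" using M_pos N_pos n_pos by (simp add: T_def)
  have "(card (pts \<times> C2 \<times> B))\<^sup>2 \<le> card sumset * card collisions"
    unfolding sumset_def collisions_def
    by (rule card_squared_le_card_image_mult_collisions) (use finite_pts finite_C finite_B in auto)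
  moreover have "card (pts \<times> C2 \<times> B) = M * M * N * n"
    by (simp add: card_cartesian_product card_pts card_C2 card_B)
  ultimately have "real ((M * M * N * n)\<^sup>2) \<le> real (card sumset * card collisions)"
    by (simp only: of_nat_le_iff)
  then have "(real M * T)\<^sup>2 * K \<le> real (card sumset) * (real (card collisions) * K)"
    using K by (simp add: T_def mult_ac)
  also have "\<dots> \<le> real (card sumset) * (real M ^ 2 * T)"
    by (intro mult_left_mono) (use c in \<open>auto simp: T_def power2_eq_square power3_eq_cube mult_ac\<close>)
  finally have "real M ^ 2 * T * (T * K) \<le> real M ^ 2 * T * real (card sumset)"
    by (simp add: power2_eq_square mult_ac)
  moreover have "real M ^ 2 * T > 0" using T M_pos by simp
  ultimately show ?thesis unfolding T_def by (metis mult_le_cancel_left_pos)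
qed

lemma reps_le: "reps d \<le> n"
proof -
  have "reps d \<le> card B" unfolding reps_def
    by (rule card_inj_on_le[where f = fst]) (auto simp: inj_on_def finite_B)
  then show ?thesis by (simp add: card_B)
qed

text \<open>The line of slope \<open>t\<close> through \<open>p\<close> meets the line through the
  origin of slope \<open>fst p'\<close> only once, because that slope is smaller than
  \<open>t\<close>.\<close>

lemma parallel_eqI:
  assumes "t \<in> C2" "(p, p') \<in> parallel t" "(p, p'') \<in> parallel t" "fst p' = fst p''"
  shows "p' = p''"
proof (rule prod_eqI)
  have "fst p' \<in> C1" "snd p' * (fst p' - t) = snd p'' * (fst p' - t)"
    using assms by (auto simp: parallel_def pts_def)
  with C12[of "fst p'" t] assms(1) show "snd p' = snd p''" by simp
qed fact

lemma card_parallel_le: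
  assumes "t \<in> C2"
  shows "card (parallel t) \<le> M * N * M"
proof -
  have "card (parallel t) \<le> card (pts \<times> C1)"
  proof (rule card_inj_on_le[where f = "\<lambda>(p, p'). (p, fst p')"])
    show "inj_on (\<lambda>(p, p'). (p, fst p')) (parallel t)"
    proof (rule inj_onI)
      fix u v assume "u \<in> parallel t" "v \<in> parallel t" "(case u of (p, p') \<Rightarrow> (p, fst p')) = (case v of (p, p') \<Rightarrow> (p, fst p'))"
      then show "u = v" by (cases u; cases v) (auto dest: parallel_eqI[OF assms])
    qed
  qed (use finite_C finite_pts in \<open>auto simp: parallel_def pts_def\<close>)
  then show ?thesis by (simp add: card_cartesian_product card_pts card_C1)
qed

text \<open>Two points with distinct abscissae determine \<open>t\<close>, which gives
  \<open>(M N)^2\<close>; parallel points with equal abscissae coincide, leaving only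
  \<open>t\<close> and \<open>p\<close> to choose.\<close>

lemma sum_card_parallel_le: "(\<Sum>t\<in>C2. card (parallel t)) \<le> M * M * N + (M * N)\<^sup>2"
proof -
  define J1 where "J1 = {(t, p, p') \<in> Sigma C2 parallel. snd p = snd p'}"
  define J2 where "J2 = {(t, p, p') \<in> Sigma C2 parallel. snd p \<noteq> snd p'}"
  have J1_eq: "p' = p" if "(t, p, p') \<in> J1" for t p p'
  proof (rule prod_eqI)
    have "snd p > 0" "snd p = snd p'" "snd p * (fst p - t) = snd p' * (fst p' - t)"
      using that pts_pos[of p] by (auto simp: J1_def parallel_def)
    then show "fst p' = fst p" "snd p' = snd p" by auto
  qed
  have J1_inj: "inj_on (\<lambda>(t, p, p'). (t, p)) J1"
    by (rule inj_onI) (auto dest: J1_eq)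
  have "card J1 \<le> card (C2 \<times> pts)"
    by (rule card_inj_on_le[where f = "\<lambda>(t, p, p'). (t, p)"])
      (use finite_C finite_pts J1_inj in \<open>auto simp: J1_def parallel_def\<close>)
  moreover have "card J2 \<le> card (pts \<times> pts)"
  proof (rule card_inj_on_le[where f = snd])
    show "inj_on snd J2"
    proof (rule inj_onI, clarsimp simp: J2_def parallel_def)
      fix t t' s a s' a' :: real
      assume "a * (s - t) = a' * (s' - t)" "a * (s - t') = a' * (s' - t')" "a \<noteq> a'"
      then have "(a - a') * (t - t') = 0" by (simp add: algebra_simps)
      with \<open>a \<noteq> a'\<close> show "t = t'" by simp
    qed
  qed (use finite_pts in \<open>auto simp: J2_def parallel_def\<close>)
  moreover have "(\<Sum>t\<in>C2. card (parallel t)) = card (Sigma C2 parallel)"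
    using finite_C finite_parallel by simp
  moreover have "Sigma C2 parallel = J1 \<union> J2" by (auto simp: J1_def J2_def)
  moreover have "card (J1 \<union> J2) \<le> card J1 + card J2" by (rule card_Un_le)
  ultimately show ?thesis
    by (simp add: card_cartesian_product card_pts card_C2 power2_eq_square mult_ac)
qed

lemma card_cross_le: "q \<in> quads \<Longrightarrow> card (cross q) \<le> N\<^sup>2"
proof -
  assume q: "q \<in> quads"
  obtain s s' t t' where [simp]: "q = (s, s', t, t')" by (cases q)
  have s: "s \<in> C1" "s' \<in> C1" using q by (auto simp: quads_def)
  have "card (cross q) \<le> card (X s \<times> X s')"
    by (intro card_mono) (use s finite_X in \<open>auto simp: cross_def\<close>)
  then show ?thesis using s by (simp add: card_cartesian_product card_X power2_eq_square)
qed

lemma card_collisions_le_trivial: "card collisions \<le> n * (M * M * N + (M * N)\<^sup>2) + M ^ 4 * N\<^sup>2"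
proof -
  have "(\<Sum>t\<in>C2. \<Sum>(p, p')\<in>parallel t. reps ((snd p' - snd p) / \<eta> t)) \<le> (\<Sum>t\<in>C2. \<Sum>p\<in>parallel t. n)"
    by (intro sum_mono) (auto simp: reps_le)
  also have "\<dots> = n * (\<Sum>t\<in>C2. card (parallel t))" by (simp add: sum_distrib_left mult.commute)
  also have "\<dots> \<le> n * (M * M * N + (M * N)\<^sup>2)" by (intro mult_left_mono sum_card_parallel_le) auto
  finally have 1: "(\<Sum>t\<in>C2. \<Sum>(p, p')\<in>parallel t. reps ((snd p' - snd p) / \<eta> t)) \<le> \<dots>" .
  have "(\<Sum>q\<in>quads. card (cross q)) \<le> (\<Sum>q\<in>quads. N\<^sup>2)" by (intro sum_mono card_cross_le)
  also have "\<dots> \<le> M ^ 4 * N\<^sup>2" using card_quads_le by simp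
  finally show ?thesis using 1 card_collisions_le by linarith
qed

text \<open>For \<open>u = a (s - t)\<close> and \<open>\<sigma> = 1 / (s - t)\<close> we have \<open>a = u \<sigma>\<close>, and points parallel to \<open>t\<close> share
  \<open>u\<close>. Hence the condition on \<open>a' - a\<close> is an incidence between the line \<open>z \<mapsto> u (z - \<sigma>)\<close> and
  the point of abscissa \<open>\<sigma>'\<close>.\<close>

lemma card_parallel_popular_le:
  assumes t: "t \<in> C2" and R: "finite R" and w: "w1 > 0" "w2 > 0"
  shows "card {(p, p') \<in> parallel t. (snd p' - snd p) / \<eta> t \<in> R}
    \<le> M * N * (M div w1 + card R div w2 + 1) + M * card R * w1 * w2"
proof -
  define y where "y = \<eta> t"
  have y: "y > 0" using t by (simp add: y_def \<eta>_pos)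
  define P where "P = (\<lambda>s. 1 / (s - t)) ` C1"
  have lt: "s - t < 0" if "s \<in> C1" for s using C12[OF that t] by simp
  have cP: "card P = M" unfolding P_def card_C1[symmetric]
    by (rule card_image) (auto simp: inj_on_def)
  have finP: "finite P" by (simp add: P_def finite_C)
  define l where "l = (\<lambda>(s, a). (a * (s - t) / y, - (a / y)))"
  have inj: "inj_on l pts"
  proof (rule inj_onI)
    fix p p' assume p: "p \<in> pts" and e: "l p = l p'"
    have "snd p = snd p'" using e y by (simp add: l_def case_prod_unfold)
    moreover have "snd p > 0" using p by (rule pts_pos)
    ultimately show "p = p'" using e y by (auto simp: l_def case_prod_unfold prod_eq_iff)
  qed
  define E where "E p = {z \<in> P. fst (l p) * z + snd (l p) \<in> R}" for p
  have "card {(p, p') \<in> parallel t. (snd p' - snd p) / \<eta> t \<in> R} \<le> card (Sigma pts E)"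
  proof (rule card_inj_on_le[where f = "\<lambda>(p, p'). (p, 1 / (fst p' - t))"])
    show "inj_on (\<lambda>(p, p'). (p, 1 / (fst p' - t))) {(p, p') \<in> parallel t. (snd p' - snd p) / \<eta> t \<in> R}"
      using parallel_eqI[OF t] by (auto simp: inj_on_def)
    show "(\<lambda>(p, p'). (p, 1 / (fst p' - t))) ` {(p, p') \<in> parallel t. (snd p' - snd p) / \<eta> t \<in> R} \<subseteq> Sigma pts E"
    proof (clarsimp simp: parallel_def)
      fix s a s' a'
      assume p: "(s, a) \<in> pts" "(s', a') \<in> pts" and e: "a * (s - t) = a' * (s' - t)"
        and r: "(a' - a) / \<eta> t \<in> R"
      have s': "s' \<in> C1" "s' - t < 0" using p lt by (auto simp: pts_def)
      then have "a * (s - t) / y * (1 / (s' - t)) + - (a / y) = (a' - a) / y"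
        unfolding e by (simp add: diff_divide_distrib)
      then have "a * (s - t) / y * (1 / (s' - t)) + - (a / y) \<in> R" using r by (simp only: y_def)
      then show "1 / (s' - t) \<in> E (s, a)" using s'
        by (simp only: E_def l_def P_def mem_Collect_eq fst_conv snd_conv prod.case image_eqI)
    qed
    show "finite (Sigma pts E)" using finite_pts finP by (auto simp: E_def)
  qed
  also have "\<dots> = (\<Sum>p\<in>pts. card (E p))" using finite_pts finP by (simp add: E_def)
  also have "\<dots> = (\<Sum>(m, c)\<in>l ` pts. card {z \<in> P. m * z + c \<in> R})"
    by (subst sum.reindex[OF inj]) (simp add: E_def case_prod_unfold)
  also have "\<dots> \<le> card (l ` pts) * (card P div w1 + card R div w2 + 1) + card P * card R * w1 * w2"
    by (intro grid_incidences_le) (use finite_pts finP R w in auto)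
  finally show ?thesis by (simp add: card_image[OF inj] card_pts cP)
qed

section \<open>Clusters with few points on each line\<close>

text \<open>The first condition in \<open>h\<close> makes the collisions with equal
  \<open>t\<close>, at most \<open>2 n (M N)^2\<close>, fit into half of the allowed
  \<open>M^3 N n / K\<close>; the second does the same for the others, at most
  \<open>M^4 N^2\<close>.\<close>

lemma card_sumset_ge_of_small_N:
  assumes K: "K > 0" and h: "4 * real N * K \<le> real M" "2 * real M * real N * K \<le> real n"
  shows "real M * real N * real n * K \<le> real (card sumset)"
proof (rule card_sumset_ge[OF K])
  have "M * M * N \<le> (M * N)\<^sup>2"
    using N_pos by (simp add: power2_eq_square mult_ac)
  then have "card collisions \<le> n * (2 * (M * N)\<^sup>2) + M ^ 4 * N\<^sup>2"
    using card_collisions_le_trivial by (smt (verit) add_mono mult_le_mono order_refl order_trans mult_2)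
  then have "real (card collisions) \<le> real (n * (2 * (M * N)\<^sup>2) + M ^ 4 * N\<^sup>2)"
    by (simp only: of_nat_le_iff)
  then have "real (card collisions) * K \<le> (2 * real n * (real M * real N)\<^sup>2 + real M ^ 4 * (real N)\<^sup>2) * K"
    using K by (intro mult_right_mono) (auto simp: power2_eq_square)
  also have "\<dots> = ((4 * real N * K) * (real M ^ 2 * real N * real n) + (2 * real M * real N * K) * (real M ^ 3 * real N)) / 2"
    by (simp add: power2_eq_square power3_eq_cube power4_eq_xxxx algebra_simps)
  also have "\<dots> \<le> (real M * (real M ^ 2 * real N * real n) + real n * (real M ^ 3 * real N)) / 2"
    by (intro divide_right_mono add_mono mult_right_mono h) auto
  also have "\<dots> = real M ^ 3 * real N * real n"
    by (simp add: power2_eq_square power3_eq_cube)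
  finally show "real (card collisions) * K \<le> real M ^ 3 * real N * real n" .
qed

section \<open>Clusters with many points on each line\<close>

lemma finite_popular: "\<tau> > 0 \<Longrightarrow> finite {d. \<tau> \<le> real (reps d)}"
proof (rule finite_subset)
  assume \<tau>: "\<tau> > 0"
  show "{d. \<tau> \<le> real (reps d)} \<subseteq> (\<lambda>(b, b'). b - b') ` (B \<times> B)"
  proof
    fix d assume "d \<in> {d. \<tau> \<le> real (reps d)}"
    with \<tau> have "reps d \<noteq> 0" by auto
    then have "{(b, b'). b \<in> B \<and> b' \<in> B \<and> b - b' = d} \<noteq> {}"
      unfolding reps_def by (metis card.empty)
    then show "d \<in> (\<lambda>(b, b'). b - b') ` (B \<times> B)" by auto
  qed
qed (use finite_B in auto)

text \<open>An unpopular difference has fewer than \<open>\<tau>\<close> representations, and each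
  \<open>t\<close> has at most \<open>M^2 N\<close> parallel pairs. A popular one costs the trivial
  \<open>n\<close>, but occurs at most \<open>I\<close> times.\<close>

lemma sum_reps_le:
  assumes \<tau>: "\<tau> > 0" and R: "R = {d. \<tau> \<le> real (reps d)}"
    and I: "\<And>t. t \<in> C2 \<Longrightarrow> real (card {(p, p') \<in> parallel t. (snd p' - snd p) / \<eta> t \<in> R}) \<le> I"
  shows "real (\<Sum>t\<in>C2. \<Sum>(p, p')\<in>parallel t. reps ((snd p' - snd p) / \<eta> t))
    \<le> real M * (real M * real N * real M * \<tau> + real n * I)"
proof -
  have "real (\<Sum>(p, p')\<in>parallel t. reps ((snd p' - snd p) / \<eta> t))
      \<le> real M * real N * real M * \<tau> + real n * I" if t: "t \<in> C2" for t
  proof -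
    define G where "G = {(p, p') \<in> parallel t. (snd p' - snd p) / \<eta> t \<in> R}"
    have G: "G \<subseteq> parallel t" by (auto simp: G_def)
    have 1: "real (reps ((snd p' - snd p) / \<eta> t)) \<le> \<tau> + (if (p, p') \<in> G then real n else 0)"
      if "(p, p') \<in> parallel t" for p p'
      using that \<tau> reps_le[of "(snd p' - snd p) / \<eta> t"] by (auto simp: G_def R)
    have "real (\<Sum>(p, p')\<in>parallel t. reps ((snd p' - snd p) / \<eta> t))
        \<le> (\<Sum>u\<in>parallel t. \<tau> + (if u \<in> G then real n else 0))"
      unfolding of_nat_sum
    proof (intro sum_mono)
      fix u assume "u \<in> parallel t"
      with 1[of "fst u" "snd u"]
      show "real (case u of (p, p') \<Rightarrow> reps ((snd p' - snd p) / \<eta> t)) \<le> \<tau> + (if u \<in> G then real n else 0)"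
        by (simp add: case_prod_unfold)
    qed
    also have "\<dots> = real (card (parallel t)) * \<tau> + real n * real (card G)"
      using G finite_parallel by (simp add: sum.distrib sum.If_cases Int_absorb1)
    also have "\<dots> \<le> real (M * N * M) * \<tau> + real n * I"
      using card_parallel_le[OF t] I[OF t] \<tau>
      by (intro add_mono mult_right_mono mult_left_mono of_nat_mono) (auto simp: G_def)
    finally show ?thesis by simp
  qed
  then have "(\<Sum>t\<in>C2. real (\<Sum>(p, p')\<in>parallel t. reps ((snd p' - snd p) / \<eta> t)))
      \<le> (\<Sum>t\<in>C2. real M * real N * real M * \<tau> + real n * I)"
    by (intro sum_mono)
  then show ?thesis by (simp add: card_C2)
qed

text \<open>First use of Szemeredi--Trotter: a set \<open>X0\<close> whose product set with
  \<open>B\<close> is small limits the differences with at least \<open>n / q^6\<close>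
  representations.\<close>

lemma card_popular_le:
  assumes q: "q \<ge> 100" and n: "4 * q ^ 6 \<le> real n"
    and X0: "finite X0" "0 \<notin> X0" "card X0 = N"
    and Y: "real (card {x * b | x b. x \<in> X0 \<and> b \<in> B}) \<le> q ^ 4 * real n"
    and R: "R = {d. real n / q ^ 6 \<le> real (reps d)}"
  shows "real N * real (card R) \<le> real n * q ^ 27"
proof -
  define Y where "Y = card {x * b | x b. x \<in> X0 \<and> b \<in> B}"
  \<comment> \<open>These lengths make each of the three summands in the bracket of the incidence
    bound at most \<open>\<tau> / 4\<close>, so three quarters of the left side are absorbed. The
    rest carries the exponent \<open>4 + 6 + 10 + 6 = 26\<close>, and one more \<open>q\<close>
    swallows the constant 100.\<close>
  define w1 w2 where "w1 = nat \<lceil>4 * q ^ 6\<rceil>" and "w2 = nat \<lceil>4 * q ^ 10\<rceil>"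
  have q1: "q ^ k \<ge> 1" for k using q by simp
  have w1: "4 * q ^ 6 \<le> real w1" "real w1 \<le> 5 * q ^ 6"
    and w2: "4 * q ^ 10 \<le> real w2" "real w2 \<le> 5 * q ^ 10"
    unfolding w1_def w2_def using q1[of 6] q1[of 10] by linarith+
  have w: "w1 > 0" "w2 > 0" using w1 w2 q1[of 6] q1[of 10] by linarith+
  define \<tau> where "\<tau> = real n / q ^ 6"
  have n0: "real n > 0" using n_pos by simp
  have \<tau>: "\<tau> > 0" "\<tau> \<ge> 4" unfolding \<tau>_def using n n0 q by (auto simp: field_simps)
  have finR: "finite R" using finite_popular[OF \<tau>(1)] by (simp add: R \<tau>_def)
  define Z where "Z = real N * real (card R)"
  have d1: "real (card B div w1) \<le> \<tau> / 4"
  proof -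
    have "real (card B div w1) \<le> real n / real w1" by (simp add: card_B of_nat_div_le_of_nat)
    also have "\<dots> \<le> real n / (4 * q ^ 6)" using w1 w q by (intro divide_left_mono) auto
    finally show ?thesis by (simp add: \<tau>_def)
  qed
  have d2: "real (Y div w2) \<le> \<tau> / 4"
  proof -
    have "real (Y div w2) \<le> real Y / real w2" by (simp add: of_nat_div_le_of_nat)
    also have "\<dots> \<le> (q ^ 4 * real n) / (4 * q ^ 10)"
      using w2 q Y by (intro frac_le) (auto simp: Y_def)
    also have "\<dots> = \<tau> / 4" using q by (simp add: \<tau>_def field_simps flip: power_add)
    finally show ?thesis .
  qed
  have "real (card X0 * card R) * \<tau> \<le>
      real (card X0 * card R * (card B div w1 + Y div w2 + 1) + card B * Y * w1 * w2)"
  proof (rule card_eq_mult_popular_differences_le)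
    show "\<tau> \<le> real (card {(b, b'). b \<in> B \<and> b' \<in> B \<and> b - b' = d})" if "d \<in> R" for d
      using that by (simp add: R \<tau>_def reps_def)
  qed (use finite_B X0 finR w in \<open>auto simp: Y_def\<close>)
  then have "Z * \<tau> \<le> Z * (real (card B div w1) + real (Y div w2) + 1) + real n * real Y * real w1 * real w2"
    by (simp add: Z_def X0 card_B distrib_left)
  also have "\<dots> \<le> Z * (\<tau> / 4 + \<tau> / 4 + \<tau> / 4) + real n * (q ^ 4 * real n) * (5 * q ^ 6) * (5 * q ^ 10)"
    using d1 d2 \<tau> w1 w2 Y q
    by (intro add_mono mult_mono mult_left_mono) (auto simp: Z_def Y_def)
  finally have "Z * \<tau> \<le> 100 * (real n * (q ^ 4 * real n) * (q ^ 6 * q ^ 10))" by (simp add: field_simps)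
  then have "Z * real n \<le> 100 * (real n * (q ^ 4 * real n) * (q ^ 6 * q ^ 10)) * q ^ 6"
    using q by (simp add: \<tau>_def pos_divide_le_eq)
  also have "\<dots> = (100 * q ^ 26 * real n) * real n" by (simp add: mult_ac flip: power_add)
  finally have "Z \<le> 100 * q ^ 26 * real n" using n0 by simp
  also have "\<dots> \<le> q * q ^ 26 * real n" using q by (intro mult_right_mono) auto
  also have "\<dots> = real n * q ^ 27" by (simp add: mult_ac flip: power_Suc)
  finally show ?thesis by (simp add: Z_def)
qed

lemma card_parallel_popular_le_of_large_N:
  assumes q: "q \<ge> 100" and t: "t \<in> C2" and R: "finite R" "real N * real (card R) \<le> real n * q ^ 27"
    and h: "q ^ 6 \<le> real M" "4 * real n * q ^ 39 \<le> real M * real N ^ 2"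
      "2 * real n ^ 2 * q ^ 72 \<le> real M ^ 2 * real N ^ 3"
  shows "real (card {(p, p') \<in> parallel t. (snd p' - snd p) / \<eta> t \<in> R}) * q ^ 6
    \<le> 5 * real M ^ 2 * real N"
proof -
  define r where "r = real (card R)"
  \<comment> \<open>Both quotients in the incidence bound become at most \<open>M / q^6\<close>.
    Adding 1 keeps \<open>w2\<close> positive when \<open>R\<close> is empty.\<close>
  define w1 w2 where "w1 = nat \<lceil>q ^ 6\<rceil>" and "w2 = nat \<lceil>r * q ^ 6 / real M\<rceil> + 1"
  have q1: "q ^ k \<ge> 1" for k using q by simp
  have M0: "real M > 0" and N0: "real N > 0" using M_pos N_pos by auto
  have r0: "r \<ge> 0" by (simp add: r_def)
  have w1: "q ^ 6 \<le> real w1" "real w1 \<le> 2 * q ^ 6"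
    unfolding w1_def using q1[of 6] by linarith+
  have "0 \<le> r * q ^ 6 / real M" using q r0 by simp
  then have w2: "r * q ^ 6 / real M \<le> real w2" "real w2 \<le> 2 + r * q ^ 6 / real M" and w20: "w2 > 0"
    unfolding w2_def by linarith+
  have w10: "w1 > 0" using w1 q1[of 6] by linarith
  have d1: "real (M div w1) * q ^ 6 \<le> real M"
  proof -
    have "real (M div w1) * q ^ 6 \<le> real M / real w1 * real w1"
      using w1 q by (intro mult_mono of_nat_div_le_of_nat) auto
    then show ?thesis using w10 by simp
  qed
  have d2: "real (card R div w2) * q ^ 6 \<le> real M"
  proof -
    have "real (card R div w2) * (r * q ^ 6 / real M) \<le> r / real w2 * real w2"
      unfolding r_def using w2(1)[unfolded r_def] q by (intro mult_mono of_nat_div_le_of_nat) auto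
    then have "real (card R div w2) * q ^ 6 * r \<le> real M * r" using w20 M0 by (simp add: field_simps)
    then show ?thesis using r0 M0
      by (cases "r = 0") (auto simp: r_def mult_le_cancel_right)
  qed
  \<comment> \<open>\<open>e1\<close> and \<open>e2\<close> control the two parts of the error term
    arising from the bound \<open>2 + r * q ^ 6 / M\<close> for \<open>w2\<close>. As
    \<open>N r \<le> n q^27\<close>, the exponents in \<open>h\<close> are
    \<open>39 = 27 + 12\<close> and \<open>72 = 2 * 27 + 18\<close>.\<close>
  have "4 * r * q ^ 12 * real N = 4 * (real N * r) * q ^ 12" by simp
  also have "\<dots> \<le> 4 * (real n * q ^ 27) * q ^ 12"
    using R q by (intro mult_left_mono mult_right_mono) (auto simp: r_def)
  also have "\<dots> \<le> real M * real N * real N"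
    using h(2) by (simp add: mult_ac power2_eq_square flip: power_add)
  finally have e1: "4 * r * q ^ 12 \<le> real M * real N" using N0 by simp
  have "2 * r ^ 2 * q ^ 18 * real N ^ 2 = 2 * (real N * r) ^ 2 * q ^ 18" by (simp add: power_mult_distrib)
  also have "\<dots> \<le> 2 * (real n * q ^ 27) ^ 2 * q ^ 18"
    using R q r0 by (intro mult_left_mono mult_right_mono power_mono) (auto simp: r_def)
  also have "\<dots> = 2 * real n ^ 2 * q ^ 72"
    by (simp add: power_mult_distrib mult_ac flip: power_add power_mult)
  also have "\<dots> \<le> real M ^ 2 * real N * real N ^ 2"
    using h(3) by (simp add: mult_ac power2_eq_square power3_eq_cube)
  finally have e2: "2 * r ^ 2 * q ^ 18 \<le> real M ^ 2 * real N" using N0 by simp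
  have "real (card {(p, p') \<in> parallel t. (snd p' - snd p) / \<eta> t \<in> R})
      \<le> real (M * N * (M div w1 + card R div w2 + 1) + M * card R * w1 * w2)"
    by (intro of_nat_mono card_parallel_popular_le t R w10 w20)
  then have "real (card {(p, p') \<in> parallel t. (snd p' - snd p) / \<eta> t \<in> R}) * q ^ 6
      \<le> real (M * N * (M div w1 + card R div w2 + 1) + M * card R * w1 * w2) * q ^ 6"
    using q by (intro mult_right_mono) auto
  also have "\<dots> = real M * real N * (real (M div w1) * q ^ 6 + real (card R div w2) * q ^ 6 + q ^ 6)
      + real M * r * real w1 * real w2 * q ^ 6"
    by (simp add: r_def algebra_simps)
  also have "\<dots> \<le> real M * real N * (real M + real M + real M)
      + real M * r * (2 * q ^ 6) * (2 + r * q ^ 6 / real M) * q ^ 6"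
    using d1 d2 h(1) w1 w2 r0 q M0 by (intro add_mono mult_left_mono mult_right_mono mult_mono) auto
  also have "\<dots> = 3 * real M ^ 2 * real N + (4 * r * q ^ 12) * real M + 2 * r ^ 2 * q ^ 18"
    using M0 by (simp add: field_simps power2_eq_square flip: power_add)
  also have "\<dots> \<le> 3 * real M ^ 2 * real N + real M * real N * real M + real M ^ 2 * real N"
    using e1 e2 M0 by (intro add_mono mult_right_mono) auto
  also have "\<dots> = 5 * real M ^ 2 * real N" by (simp add: power2_eq_square)
  finally show ?thesis .
qed

text \<open>The bound is a factor \<open>q^6\<close> below \<open>N n / M\<close>, the value at
  which \<open>M^4\<close> quadruples would exhaust the budget \<open>M^3 N n\<close>. The small
  product set of \<open>X0\<close> feeds \<open>card_mult_affine_pairs_le\<close>.\<close>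

lemma card_cross_le_of_large_N:
  assumes q: "q \<ge> 100" and u: "u \<in> quads"
    and X0: "finite X0" "0 \<notin> X0" "card X0 = N"
    and Y: "real (card {x * b | x b. x \<in> X0 \<and> b \<in> B}) \<le> q ^ 4 * real n"
    and h: "real M * q ^ 7 \<le> real n" "2 * real M ^ 2 * q ^ 22 \<le> real N" "2 * real M ^ 3 * q ^ 29 \<le> real n"
  shows "real (card (cross u)) * (real M * q ^ 6) \<le> real N * real n"
proof -
  obtain s s' t t' where u_eq: "u = (s, s', t, t')" by (cases u)
  have st: "s \<in> C1" "s' \<in> C1" "t \<in> C2" "t' \<in> C2" "t \<noteq> t'" using u by (auto simp: quads_def u_eq)
  define Y where "Y = card {x * b | x b. x \<in> X0 \<and> b \<in> B}"
  \<comment> \<open>Both quotients become at most \<open>n / (M q^7)\<close>. Aiming at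
    \<open>q^7\<close> instead of \<open>q^6\<close> leaves a factor \<open>q\<close> for the
    constant 5.\<close>
  define w1 w2 where "w1 = nat \<lceil>real N * real M * q ^ 7 / real n\<rceil>" and "w2 = nat \<lceil>real M * q ^ 11\<rceil>"
  have pos: "real M > 0" "real N > 0" "real n > 0" "q > 0" and M1: "real M \<ge> 1"
    using M_pos N_pos n_pos q by auto
  have "real N * real M * q ^ 7 / real n > 0" using pos by simp
  then have w1: "real N * real M * q ^ 7 / real n \<le> real w1"
      "real w1 \<le> 1 + real N * real M * q ^ 7 / real n" and w10: "w1 > 0"
    unfolding w1_def by linarith+
  have "real M * q ^ 11 \<ge> 1 * 1" using M1 q by (intro mult_mono) auto
  then have w2: "real M * q ^ 11 \<le> real w2" "real w2 \<le> 2 * (real M * q ^ 11)" and w20: "w2 > 0"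
    unfolding w2_def by linarith+
  define c where "c = real (card (cross u))"
  define Q where "Q = real M * q ^ 7"
  have Q: "Q > 0" using pos by (simp add: Q_def)
  have d1: "real (N div w1) * Q \<le> real n"
  proof -
    have "real (N div w1) * (real N * real M * q ^ 7 / real n) \<le> real N / real w1 * real w1"
      using w1 pos by (intro mult_mono of_nat_div_le_of_nat) auto
    then have "real N * (real (N div w1) * Q) \<le> real N * real n"
      using w10 pos by (simp add: field_simps Q_def)
    then show ?thesis using pos by simp
  qed
  have d2: "real (Y div w2) * Q \<le> real n"
  proof -
    have "real (Y div w2) * (real M * q ^ 11) \<le> real Y / real w2 * real w2"
      using w2 pos by (intro mult_mono of_nat_div_le_of_nat) auto
    also have "\<dots> \<le> q ^ 4 * real n" using w20 Y by (simp add: Y_def)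
    also have "real (Y div w2) * (real M * q ^ 11) = q ^ 4 * (real (Y div w2) * Q)"
      by (simp add: Q_def mult_ac flip: power_add)
    finally show ?thesis using pos by simp
  qed
  have nz: "(s - t') / (\<eta> t * (t - t')) \<noteq> 0" "(s' - t') / (\<eta> t * (t - t')) \<noteq> 0"
    using C12[of s t'] C12[of s' t'] \<eta>_pos[of t] st by auto
  have "card X0 * card (cross u) \<le> card X0 * card (X s) * (card (X s') div w1 + Y div w2 + 1) + card (X s') * Y * w1 * w2"
    unfolding u_eq cross_def prod.case
    by (rule card_mult_affine_pairs_le) (use finite_B X0 finite_X st w10 w20 nz in \<open>auto simp: Y_def\<close>)
  then have "N * card (cross u) \<le> N * N * (N div w1 + Y div w2 + 1) + N * Y * w1 * w2"
    using st by (simp add: X0 card_X)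
  then have "real (N * card (cross u)) \<le> real (N * N * (N div w1 + Y div w2 + 1) + N * Y * w1 * w2)"
    by (simp only: of_nat_le_iff)
  then have "real N * c \<le> real N * (real N * (real (N div w1) + real (Y div w2) + 1) + real Y * real w1 * real w2)"
    by (simp add: c_def algebra_simps)
  then have "c \<le> real N * (real (N div w1) + real (Y div w2) + 1) + real Y * real w1 * real w2"
    using pos by simp
  then have "c * Q \<le> (real N * (real (N div w1) + real (Y div w2) + 1) + real Y * real w1 * real w2) * Q"
    using Q by (intro mult_right_mono) auto
  also have "\<dots> = real N * (real (N div w1) * Q + real (Y div w2) * Q + Q) + real Y * real w1 * real w2 * Q"
    by (simp add: algebra_simps)
  also have "\<dots> \<le> real N * (real n + real n + real n)
      + (q ^ 4 * real n) * (1 + real N * real M * q ^ 7 / real n) * (2 * (real M * q ^ 11)) * Q"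
    using d1 d2 h(1) w1 w2 Y Q pos
    by (intro add_mono mult_left_mono mult_right_mono mult_mono) (auto simp: Q_def Y_def)
  also have "\<dots> = 3 * (real N * real n) + (2 * real M ^ 2 * q ^ 22) * real n + (2 * real M ^ 3 * q ^ 29) * real N"
    using pos by (simp add: Q_def field_simps power2_eq_square power3_eq_cube flip: power_add)
  also have "\<dots> \<le> 3 * (real N * real n) + real N * real n + real n * real N"
    using h pos by (intro add_mono mult_right_mono) auto
  finally have "c * Q \<le> 5 * (real N * real n)" by simp
  then have "q * (c * (real M * q ^ 6)) \<le> 5 * (real N * real n)"
    using power_Suc[of q 6] by (simp add: Q_def mult_ac)
  also have "\<dots> \<le> q * (real N * real n)" using q by (intro mult_right_mono) auto
  finally show ?thesis using pos by (simp add: c_def)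
qed

text \<open>With \<open>T = M^3 N n\<close>, unpopular differences contribute at most
  \<open>T / q^6\<close>, popular ones \<open>5 T / q^6\<close> and collisions with distinct
  \<open>t\<close> another \<open>T / q^6\<close>. The total \<open>7 T / q^6\<close> is below
  \<open>T / q^4\<close>.\<close>

lemma card_sumset_ge_of_large_N:
  assumes q: "q \<ge> 100" and X0: "finite X0" "0 \<notin> X0" "card X0 = N"
    and Y: "real (card {x * b | x b. x \<in> X0 \<and> b \<in> B}) \<le> q ^ 4 * real n"
    and n: "4 * q ^ 6 \<le> real n"
    and h: "q ^ 6 \<le> real M" "4 * real n * q ^ 39 \<le> real M * real N ^ 2"
      "2 * real n ^ 2 * q ^ 72 \<le> real M ^ 2 * real N ^ 3"
    and cross: "\<And>u. u \<in> quads \<Longrightarrow> real (card (cross u)) * (real M * q ^ 6) \<le> real N * real n"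
  shows "real M * real N * real n * q ^ 4 \<le> real (card sumset)"
proof (rule card_sumset_ge)
  define \<tau> where "\<tau> = real n / q ^ 6"
  define R where "R = {d. \<tau> \<le> real (reps d)}"
  define T where "T = real M ^ 3 * real N * real n"
  have pos: "real M > 0" "real N > 0" "real n > 0" "q > 0" using M_pos N_pos n_pos q by auto
  have \<tau>: "\<tau> > 0" using pos by (simp add: \<tau>_def)
  have finR: "finite R" unfolding R_def by (rule finite_popular[OF \<tau>])
  have NR: "real N * real (card R) \<le> real n * q ^ 27"
    by (rule card_popular_le[OF q n X0 Y]) (simp add: R_def \<tau>_def)
  have "real (\<Sum>t\<in>C2. \<Sum>(p, p')\<in>parallel t. reps ((snd p' - snd p) / \<eta> t))
      \<le> real M * (real M * real N * real M * \<tau> + real n * (5 * real M ^ 2 * real N / q ^ 6))"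
    by (rule sum_reps_le[OF \<tau> R_def])
      (use card_parallel_popular_le_of_large_N[OF q _ finR NR h] pos in \<open>simp add: pos_le_divide_eq\<close>)
  also have "\<dots> = 6 * T / q ^ 6"
    by (simp add: \<tau>_def T_def power2_eq_square power3_eq_cube add_divide_distrib[symmetric] mult_ac)
  finally have 1: "real (\<Sum>t\<in>C2. \<Sum>(p, p')\<in>parallel t. reps ((snd p' - snd p) / \<eta> t)) \<le> 6 * T / q ^ 6" .
  have "real (\<Sum>u\<in>quads. card (cross u)) \<le> (\<Sum>u\<in>quads. real N * real n / (real M * q ^ 6))"
    unfolding of_nat_sum using cross pos by (intro sum_mono) (simp add: pos_le_divide_eq)
  also have "\<dots> = real (card quads) * (real N * real n / (real M * q ^ 6))" by simp
  also have "\<dots> \<le> real (M ^ 4) * (real N * real n / (real M * q ^ 6))"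
    using card_quads_le pos by (intro mult_right_mono of_nat_mono) auto
  also have "\<dots> = T / q ^ 6" using pos by (simp add: T_def field_simps power4_eq_xxxx power3_eq_cube)
  finally have 2: "real (\<Sum>u\<in>quads. card (cross u)) \<le> T / q ^ 6" .
  have "real (card collisions) \<le> 6 * T / q ^ 6 + T / q ^ 6"
    using 1 2 of_nat_mono[OF card_collisions_le, where 'a = real] by (simp only: of_nat_add)
  then have "real (card collisions) * q ^ 4 \<le> (7 * T / q ^ 6) * q ^ 4"
    using pos by (intro mult_right_mono) auto
  also have "\<dots> = 7 / q ^ 2 * T" using pos by (simp add: field_simps flip: power_add)
  also have "\<dots> \<le> 1 * T"
  proof (intro mult_right_mono)
    have "7 \<le> q" using q by simp
    also have "q \<le> q ^ 2" using q self_le_power[of q 2] by simp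
    finally show "7 / q ^ 2 \<le> 1" using pos by simp
  qed (use pos in \<open>auto simp: T_def\<close>)
  finally show "real (card collisions) * q ^ 4 \<le> real M ^ 3 * real N * real n" by (simp add: T_def)
qed (use q in simp)

end

section \<open>Summing over the clusters\<close>

text \<open>Sort \<open>S\<close> and cut it into blocks of \<open>2 M\<close> consecutive slopes,
  with lower half \<open>C1\<close> and upper half \<open>C2\<close>. Points counted for a block lie
  strictly between its extreme slopes, so different blocks count disjoint parts of
  \<open>D \<times> D\<close>.\<close>

lemma sector_clusters:
  fixes S D :: "real set"
  assumes fin: "finite S" "finite D" and M: "M > 0"
    and V: "\<And>C1 C2. C1 \<subseteq> S \<Longrightarrow> C2 \<subseteq> S \<Longrightarrow> card C1 = M \<Longrightarrow> card C2 = M \<Longrightarrow>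
      (\<And>s t. s \<in> C1 \<Longrightarrow> t \<in> C2 \<Longrightarrow> s < t) \<Longrightarrow>
      V \<le> real (card {(x, y). x \<in> D \<and> y \<in> D \<and> x > 0 \<and> (\<exists>s\<in>C1. \<exists>t\<in>C2. s * x < y \<and> y < t * x)})"
  shows "real (card S div (2 * M)) * V \<le> (real (card D))\<^sup>2"
proof -
  define e where "e i = sorted_list_of_set S ! i" for i
  have e_mono: "e i < e j" if "i < j" "j < card S" for i j
    unfolding e_def using that fin strict_sorted_list_of_set[of S]
    by (simp add: sorted_wrt_iff_nth_less)
  have e_le: "e i \<le> e j" if "i \<le> j" "j < card S" for i j
    using e_mono[of i j] that by (cases "i = j") auto
  have e_S: "e i \<in> S" if "i < card S" for i
    unfolding e_def using that fin by (metis length_sorted_list_of_set nth_mem set_sorted_list_of_set)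
  have e_inj: "inj_on e {..<card S}"
    by (rule inj_onI) (metis e_mono lessThan_iff less_irrefl linorder_less_linear)
  define k where "k = card S div (2 * M)"
  have kM: "k * (2 * M) \<le> card S" by (simp add: k_def)
  have idx: "j * (2 * M) + i < card S" if "j < k" "i < 2 * M" for i j
  proof -
    have "j * (2 * M) + i < Suc j * (2 * M)" using that by simp
    also have "\<dots> \<le> k * (2 * M)" using that by (intro mult_right_mono) auto
    finally show ?thesis using kM by linarith
  qed
  define C1 where "C1 j = e ` {j * (2 * M)..<j * (2 * M) + M}" for j
  define C2 where "C2 j = e ` {j * (2 * M) + M..<j * (2 * M) + 2 * M}" for j
  define W where "W j = {(x, y). x \<in> D \<and> y \<in> D \<and> x > 0 \<and>
    (\<exists>s\<in>C1 j. \<exists>t\<in>C2 j. s * x < y \<and> y < t * x)}" for j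
  have C1: "C1 j \<subseteq> S" "card (C1 j) = M" and C2: "C2 j \<subseteq> S" "card (C2 j) = M"
    and C12: "\<And>s t. s \<in> C1 j \<Longrightarrow> t \<in> C2 j \<Longrightarrow> s < t" if j: "j < k" for j
  proof -
    have lt: "i < card S" if "i < j * (2 * M) + 2 * M" for i
      using idx[OF j, of "2 * M - 1"] that M by linarith
    show "C1 j \<subseteq> S" "C2 j \<subseteq> S" using lt e_S by (auto simp: C1_def C2_def)
    show "card (C1 j) = M" "card (C2 j) = M"
      unfolding C1_def C2_def using lt
      by (subst card_image; force intro!: inj_on_subset[OF e_inj])+
    show "\<And>s t. s \<in> C1 j \<Longrightarrow> t \<in> C2 j \<Longrightarrow> s < t"
      using lt by (auto simp: C1_def C2_def intro!: e_mono)
  qed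
  have finW: "finite (W j)" for j
    by (rule finite_subset[of _ "D \<times> D"]) (use fin in \<open>auto simp: W_def\<close>)
  have disj: "W i \<inter> W j = {}" if "i < j" "j < k" for i j
  proof -
    have False if p: "(x, y) \<in> W i" "(x, y) \<in> W j" for x y
    proof -
      obtain t where t: "t \<in> C2 i" "y < t * x" using p by (auto simp: W_def)
      obtain s where s: "s \<in> C1 j" "s * x < y" and x: "x > 0" using p by (auto simp: W_def)
      obtain i1 where i1: "t = e i1" "i1 < i * (2 * M) + 2 * M" using t by (auto simp: C2_def)
      obtain j1 where j1: "s = e j1" "j * (2 * M) \<le> j1" "j1 < j * (2 * M) + M"
        using s by (auto simp: C1_def)
      have "Suc i * (2 * M) \<le> j * (2 * M)" using \<open>i < j\<close> by (intro mult_right_mono) auto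
      then have "i1 \<le> j1" using i1 j1 by simp
      moreover have "j1 < card S" using idx[OF \<open>j < k\<close>, of "j1 - j * (2 * M)"] j1 by simp
      ultimately have "t \<le> s" using e_le i1 j1 by simp
      then have "t * x \<le> s * x" using x by simp
      with t s show False by simp
    qed
    then show ?thesis by fastforce
  qed
  have "real k * V = (\<Sum>j<k. V)" by simp
  also have "\<dots> \<le> (\<Sum>j<k. real (card (W j)))"
    unfolding W_def by (intro sum_mono V) (use C1 C2 C12 in auto)
  also have "\<dots> = real (card (\<Union>j<k. W j))"
  proof (subst card_UN_disjoint)
    show "\<forall>i\<in>{..<k}. \<forall>j\<in>{..<k}. i \<noteq> j \<longrightarrow> W i \<inter> W j = {}"
      by (metis disj inf_commute lessThan_iff linorder_neqE_nat)
  qed (use finW in auto)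
  also have "\<dots> \<le> real (card (D \<times> D))"
    using fin by (intro of_nat_mono card_mono) (auto simp: W_def)
  finally show ?thesis by (simp add: k_def card_cartesian_product power2_eq_square)
qed

section \<open>Slopes with a common number of points\<close>

text \<open>\<open>X s\<close> lists the abscissae of \<open>N\<close> points of
  \<open>A \<times> A\<close> on the line of slope \<open>s\<close>; equal sizes let one
  \<open>N\<close> serve every cluster.\<close>

locale rich_slopes =
  fixes A B S :: "real set" and X :: "real \<Rightarrow> real set" and N :: nat
  assumes finite_A: "finite A" and finite_B: "finite B" and finite_S: "finite S"
    and A_pos: "\<And>a. a \<in> A \<Longrightarrow> a > 0" and B_pos: "\<And>b. b \<in> B \<Longrightarrow> b > 0"
    and X_A: "\<And>s a. s \<in> S \<Longrightarrow> a \<in> X s \<Longrightarrow> a \<in> A"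
    and sX_A: "\<And>s a. s \<in> S \<Longrightarrow> a \<in> X s \<Longrightarrow> s * a \<in> A"
    and card_X: "\<And>s. s \<in> S \<Longrightarrow> card (X s) = N" and N_pos: "N > 0"
    and B_nonempty: "B \<noteq> {}"
begin

definition D :: "real set" where "D = {a * b + a' | a a' b. a \<in> A \<and> a' \<in> A \<and> b \<in> B}"

definition sector :: "real set \<Rightarrow> real set \<Rightarrow> (real \<times> real) set" where
  "sector C1 C2 = {(x, y). x \<in> D \<and> y \<in> D \<and> x > 0 \<and> (\<exists>s\<in>C1. \<exists>t\<in>C2. s * x < y \<and> y < t * x)}"

lemma finite_D: "finite D"
proof -
  have "D = (\<lambda>(a, a', b). a * b + a') ` (A \<times> A \<times> B)" by (force simp: D_def)
  then show ?thesis using finite_A finite_B by simp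
qed

lemma finite_sector: "finite (sector C1 C2)"
  by (rule finite_subset[of _ "D \<times> D"]) (auto simp: sector_def finite_D)

lemma finite_X: "s \<in> S \<Longrightarrow> finite (X s)"
  using card_X N_pos card_ge_0_finite by metis

text \<open>A vector of slope \<open>s\<close> plus a positive multiple of a vector of slope
  \<open>t\<close> has a slope strictly between them. The coordinates lie in \<open>D\<close> since
  \<open>a\<close>, \<open>s * a\<close>, \<open>c\<close> and \<open>t * c\<close> lie in
  \<open>A\<close>.\<close>

lemma sum_in_sector:
  assumes "s \<in> C1" "t \<in> C2" "s \<in> S" "t \<in> S" "s < t" "a \<in> X s" "c \<in> X t" "b \<in> B"
  shows "(a + b * c, s * a + b * (t * c)) \<in> sector C1 C2"
proof -
  have pos: "a > 0" "c > 0" "b > 0" using assms A_pos B_pos X_A by auto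
  have in_D: "a + b * c \<in> D" "s * a + b * (t * c) \<in> D"
    unfolding D_def using assms X_A sX_A by (auto, (metis add.commute mult.commute)+)
  have "s * (b * c) < t * (b * c)" "s * a < t * a" using assms pos by simp_all
  then have "s * (a + b * c) < s * a + b * (t * c)" "s * a + b * (t * c) < t * (a + b * c)"
    by (simp_all add: algebra_simps)
  then show ?thesis using in_D pos assms by (auto simp: sector_def intro!: add_pos_pos)
qed

text \<open>If every cluster produced \<open>M N n q^4\<close> points,
  \<open>sector_clusters\<close> would give
  \<open>|D|^2 \<ge> |S| N n q^4 / 4 \<ge> q^2 n^3 / 4\<close>, which exceeds
  \<open>q n^3\<close>.\<close>

lemma small_sector:
  assumes q: "q \<ge> 100" and D: "(real (card D))\<^sup>2 < q * real n ^ 3"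
    and S: "real n ^ 2 \<le> real (card S) * real N * q ^ 2" and n: "n > 0"
    and M: "M > 0" "2 * M \<le> card S"
  obtains C1 C2 where "C1 \<subseteq> S" "C2 \<subseteq> S" "card C1 = M" "card C2 = M"
    "\<And>s t. s \<in> C1 \<Longrightarrow> t \<in> C2 \<Longrightarrow> s < t"
    "real (card (sector C1 C2)) < real M * real N * real n * q ^ 4"
proof (rule ccontr)
  assume no: "\<not> thesis"
  define V where "V = real M * real N * real n * q ^ 4"
  have V0: "V \<ge> 0" using q by (simp add: V_def)
  \<comment> \<open>At least one cluster is complete, so rounding down costs at most a factor
    2.\<close>
  have k: "real (card S) \<le> 4 * real M * real (card S div (2 * M))"
  proof -
    define k where "k = card S div (2 * M)"
    have "card S = k * (2 * M) + card S mod (2 * M)" by (simp only: k_def div_mult_mod_eq)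
    moreover have "card S mod (2 * M) < 2 * M" using M by simp
    moreover have "1 \<le> k" unfolding k_def using M by (simp add: div_greater_zero_iff Suc_leI)
    then have "2 * M \<le> k * (2 * M)" by simp
    ultimately have "card S \<le> 2 * (k * (2 * M))" by linarith
    then have "card S \<le> 4 * M * k" by (simp add: mult_ac)
    then have "real (card S) \<le> real (4 * M * k)" by (simp only: of_nat_le_iff)
    then show ?thesis by (simp add: k_def)
  qed
  have "real (card S div (2 * M)) * V \<le> (real (card D))\<^sup>2"
  proof (rule sector_clusters)
    fix C1 C2 assume C: "C1 \<subseteq> S" "C2 \<subseteq> S" "card C1 = M" "card C2 = M"
      "\<And>s t. s \<in> C1 \<Longrightarrow> t \<in> C2 \<Longrightarrow> s < t"
    have "V \<le> real (card (sector C1 C2))"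
    proof (rule ccontr)
      assume "\<not> ?thesis"
      then have "thesis" by (intro that[OF C]) (simp_all add: V_def)
      with no show False ..
    qed
    then show "V \<le> real (card {(x, y). x \<in> D \<and> y \<in> D \<and> x > 0 \<and> (\<exists>s\<in>C1. \<exists>t\<in>C2. s * x < y \<and> y < t * x)})"
      by (simp only: sector_def)
  qed (use finite_S finite_D M in auto)
  then have "4 * real M * (real (card S div (2 * M)) * V) < 4 * real M * (q * real n ^ 3)"
    using D M by simp
  moreover have "real (card S) * V \<le> 4 * real M * real (card S div (2 * M)) * V"
    using k V0 by (rule mult_right_mono)
  ultimately have "real (card S) * V < 4 * real M * (q * real n ^ 3)" by (simp add: mult_ac)
  then have "real M * (real (card S) * real N * q ^ 2 * (real n * q ^ 2)) < real M * (4 * q * real n ^ 3)"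
    by (simp add: V_def mult_ac flip: power_add)
  then have "real (card S) * real N * q ^ 2 * (real n * q ^ 2) < 4 * q * real n ^ 3"
    using M by simp
  moreover have "real n ^ 2 * (real n * q ^ 2) \<le> real (card S) * real N * q ^ 2 * (real n * q ^ 2)"
    using S q by (intro mult_right_mono) auto
  ultimately have "(q * real n ^ 3) * q < (q * real n ^ 3) * 4"
    by (simp add: power2_eq_square power3_eq_cube mult_ac)
  moreover have "q * real n ^ 3 > 0" using q n by simp
  ultimately have "q < 4" by (simp only: mult_less_cancel_left_pos)
  with q show False by simp
qed

lemma cluster_sumset_le:
  assumes "M > 0" "C1 \<subseteq> S" "C2 \<subseteq> S" "card C1 = M" "card C2 = M"
    "\<And>s t. s \<in> C1 \<Longrightarrow> t \<in> C2 \<Longrightarrow> s < t"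
    and \<eta>: "\<And>t. t \<in> S \<Longrightarrow> \<eta> t \<in> X t"
  shows "cluster C1 C2 B X \<eta> M N (card B)"
    and "card (cluster.sumset C1 C2 B X \<eta>) \<le> card (sector C1 C2)"
proof -
  show cl: "cluster C1 C2 B X \<eta> M N (card B)"
  proof
    show "card B > 0" using finite_B B_nonempty by (simp add: card_gt_0_iff)
    show "s \<in> C1 \<Longrightarrow> a \<in> X s \<Longrightarrow> a > 0" for s a using assms(2) A_pos X_A by blast
    show "t \<in> C2 \<Longrightarrow> \<eta> t > 0" for t using assms(3) A_pos X_A \<eta> by blast
  qed (use assms finite_B finite_X card_X N_pos in auto)
  interpret cluster C1 C2 B X \<eta> M N "card B" by (rule cl)
  show "card sumset \<le> card (sector C1 C2)"
  proof (intro card_mono finite_sector)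
    show "sumset \<subseteq> sector C1 C2"
      unfolding sumset_def vec_sum_def pts_def
      using assms by (auto intro!: sum_in_sector)
  qed
qed

text \<open>Take clusters with \<open>M = 1\<close>, but use all points of the upper line. As
  \<open>s \<noteq> t\<close>, the \<open>N * card Z\<close> sums are distinct, and a sector with
  fewer than \<open>N n q^4\<close> points has to hold them.\<close>

lemma small_dilate:
  assumes q: "q \<ge> 100" and D: "(real (card D))\<^sup>2 < q * real n ^ 3"
    and S: "real n ^ 2 \<le> real (card S) * real N * q ^ 2" and n: "n > 0" and S2: "2 \<le> card S"
  obtains t where "t \<in> S" "real (card {x * b | x b. x \<in> X t \<and> b \<in> B}) \<le> q ^ 4 * real n"
proof -
  obtain C1 C2 where C: "C1 \<subseteq> S" "C2 \<subseteq> S" "card C1 = 1" "card C2 = 1"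
    and lt: "\<And>s t. s \<in> C1 \<Longrightarrow> t \<in> C2 \<Longrightarrow> s < t"
    and sec: "real (card (sector C1 C2)) < real 1 * real N * real n * q ^ 4"
    by (rule small_sector[OF q D S n, of 1]) (use S2 in auto)
  obtain s t where st: "C1 = {s}" "C2 = {t}" using C by (auto simp: card_1_singleton_iff)
  have S: "s \<in> S" "t \<in> S" "s < t" using st C lt by auto
  define Z where "Z = {x * b | x b. x \<in> X t \<and> b \<in> B}"
  have "Z = (\<lambda>(x, b). x * b) ` (X t \<times> B)" by (auto simp: Z_def)
  then have finZ: "finite Z" using finite_B finite_X S by simp
  have "card (X s \<times> Z) \<le> card (sector C1 C2)"
  proof (rule card_inj_on_le[where f = "\<lambda>(a, z). (a + z, s * a + t * z)"])
    show "inj_on (\<lambda>(a, z). (a + z, s * a + t * z)) (X s \<times> Z)"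
    proof (rule inj_onI, clarsimp)
      fix a z a' z' assume e: "a + z = a' + z'" "s * a + t * z = s * a' + t * z'"
      have "s * (a + z) = s * (a' + z')" using e by simp
      with e(2) have "(t - s) * (z - z') = 0" by (simp add: algebra_simps)
      with S have "z = z'" by simp
      with e show "a = a' \<and> z = z'" by simp
    qed
    show "(\<lambda>(a, z). (a + z, s * a + t * z)) ` (X s \<times> Z) \<subseteq> sector C1 C2"
    proof (clarsimp simp: Z_def)
      fix a c b assume "a \<in> X s" "c \<in> X t" "b \<in> B"
      then have "(a + b * c, s * a + b * (t * c)) \<in> sector C1 C2"
        using S st by (intro sum_in_sector) auto
      then show "(a + c * b, s * a + t * (c * b)) \<in> sector C1 C2" by (simp add: mult_ac)
    qed
  qed (rule finite_sector)
  then have "N * card Z \<le> card (sector C1 C2)"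
    using S by (simp add: card_cartesian_product card_X)
  then have "real (N * card Z) \<le> real (card (sector C1 C2))" by (rule of_nat_mono)
  with sec have "real N * real (card Z) \<le> real N * (q ^ 4 * real n)" by (simp add: mult_ac)
  then have "real (card Z) \<le> q ^ 4 * real n" using N_pos by simp
  with S that show thesis by (simp add: Z_def)
qed

text \<open>Up to constants, a cluster size \<open>M\<close> needs \<open>N \<le> M\<close> and \<open>M N \<le> n\<close> for small \<open>N\<close>, and
  \<open>n\<^sup>2 \<le> M\<^sup>2 N\<^sup>3\<close> for large \<open>N\<close> together with \<open>M N \<le> n\<close> or \<open>M\<^sup>2 \<le> N, M\<^sup>3 \<le> n\<close>. The exponents of \<open>q\<close> leave
  room in each of these.\<close>

lemma card_D_squared_ge:
  assumes q: "q \<ge> 100" and n: "n = card B" "real n = q ^ 4000"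
    and N_le: "N \<le> n" and S: "real n ^ 2 \<le> real (card S) * real N * q ^ 2"
  shows "q * real n ^ 3 \<le> (real (card D))\<^sup>2"
proof (rule ccontr)
  assume "\<not> ?thesis"
  then have D: "(real (card D))\<^sup>2 < q * real n ^ 3" by simp
  have q0: "q > 0" and q1: "q \<ge> 1" using q by auto
  have mono: "q ^ i \<le> q ^ j" if "i \<le> j" for i j using q1 that by (rule power_increasing[rotated])
  have scale: "c * q ^ i \<le> q ^ Suc i" if "c \<le> 100" for c i
    using that q q0 by (simp add: mult_right_mono)
  have "real n > 0" unfolding n(2) using q0 by simp
  then have n0: "real n > 0" "n > 0" by simp_all
  \<comment> \<open>\<open>N \<le> n\<close> forces at least \<open>n / q^2\<close> slopes, enough
    for the cluster sizes chosen below.\<close>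
  have cS: "q ^ 3998 \<le> real (card S)"
  proof -
    have "q ^ 3998 * (real n * q ^ 2) = real n * real n"
      by (simp add: n(2) mult_ac flip: power_add)
    also have "\<dots> \<le> real (card S) * real N * q ^ 2" using S by (simp add: power2_eq_square)
    also have "\<dots> \<le> real (card S) * real n * q ^ 2"
      using N_le q0 by (intro mult_right_mono mult_left_mono) auto
    finally have "q ^ 3998 * (real n * q ^ 2) \<le> real (card S) * (real n * q ^ 2)" by (simp add: mult_ac)
    moreover have "real n * q ^ 2 > 0" using n0 q0 by simp
    ultimately show ?thesis by (rule mult_right_le_imp_le)
  qed
  define \<eta> where "\<eta> t = (SOME a. a \<in> X t)" for t
  have \<eta>: "\<eta> t \<in> X t" if "t \<in> S" for t
    unfolding \<eta>_def using card_X[OF that] N_pos by (metis card.empty less_irrefl someI_ex ex_in_conv)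
  \<comment> \<open>Both ranges of \<open>N\<close> end here: a single \<open>M\<close> for which
    every cluster reaches \<open>M N n q^4\<close> contradicts \<open>small_sector\<close>.\<close>
  have contr: False if M: "M > 0" "2 * real M \<le> q ^ 3998"
    and big: "\<And>C1 C2. cluster C1 C2 B X \<eta> M N n \<Longrightarrow>
      real M * real N * real n * q ^ 4 \<le> real (card (cluster.sumset C1 C2 B X \<eta>))" for M
  proof -
    have "2 * M \<le> card S" using M cS by linarith
    then obtain C1 C2 where C: "C1 \<subseteq> S" "C2 \<subseteq> S" "card C1 = M" "card C2 = M"
      and lt: "\<And>s t. s \<in> C1 \<Longrightarrow> t \<in> C2 \<Longrightarrow> s < t"
      and sec: "real (card (sector C1 C2)) < real M * real N * real n * q ^ 4"
      using small_sector[OF q D S n0(2) M(1)] by metis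
    note cl = cluster_sumset_le[OF M(1) C lt \<eta>]
    have "real M * real N * real n * q ^ 4 \<le> real (card (cluster.sumset C1 C2 B X \<eta>))"
      by (rule big) (use cl(1) in \<open>simp add: n(1)\<close>)
    also have "\<dots> \<le> real (card (sector C1 C2))" using cl(2) by (rule of_nat_mono)
    finally show False using sec by simp
  qed
  have between: "\<exists>M>0. q ^ k \<le> real M \<and> real M \<le> q ^ Suc k" for k
  proof (intro exI conjI)
    have "real (nat \<lceil>q ^ k\<rceil>) \<ge> q ^ k" by (rule real_nat_ceiling_ge)
    then show "q ^ k \<le> real (nat \<lceil>q ^ k\<rceil>)" .
    have "q ^ k \<ge> 1" using q1 by simp
    then show "nat \<lceil>q ^ k\<rceil> > 0" by simp
    have "real (nat \<lceil>q ^ k\<rceil>) \<le> 2 * q ^ k" using \<open>q ^ k \<ge> 1\<close> by linarith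
    also have "\<dots> \<le> q ^ Suc k" by (rule scale) simp
    finally show "real (nat \<lceil>q ^ k\<rceil>) \<le> q ^ Suc k" .
  qed
  show False
  \<comment> \<open>The split point suits both sides: \<open>2001 + 1900 + 4 + 1 \<le> 4000\<close>
    for \<open>M\<close> about \<open>q^2000\<close>, and
    \<open>2 * 1240 + 3 * 1900 = 8180 \<ge> 2 * 4000 + 72 + 1\<close> for \<open>M\<close> about
    \<open>q^1240\<close>.\<close>
  proof (cases "real N \<le> q ^ 1900")
    case True
    obtain M where M: "M > 0" "q ^ 2000 \<le> real M" "real M \<le> q ^ 2001"
      using between[of 2000] by auto
    show False
    proof (rule contr[of M])
      have "2 * real M \<le> 2 * q ^ 2001" using M by simp
      also have "\<dots> \<le> q ^ Suc 2001" by (rule scale) simp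
      also have "\<dots> \<le> q ^ 3998" by (rule mono) simp
      finally show "2 * real M \<le> q ^ 3998" .
      fix C1 C2 assume "cluster C1 C2 B X \<eta> M N n"
      then interpret cluster C1 C2 B X \<eta> M N n .
      show "real M * real N * real n * q ^ 4 \<le> real (card sumset)"
      proof (rule card_sumset_ge_of_small_N)
        have "4 * real N * q ^ 4 \<le> 4 * q ^ 1900 * q ^ 4"
          using True q0 by (intro mult_right_mono mult_left_mono) auto
        also have "\<dots> = 4 * q ^ 1904" by (simp flip: power_add)
        also have "\<dots> \<le> q ^ Suc 1904" by (rule scale) simp
        also have "\<dots> \<le> q ^ 2000" by (rule mono) simp
        finally show "4 * real N * q ^ 4 \<le> real M" using M by simp
        have "2 * real M * real N * q ^ 4 \<le> 2 * q ^ 2001 * q ^ 1900 * q ^ 4"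
          using True M q0 by (intro mult_mono) auto
        also have "\<dots> = 2 * q ^ 3905" by (simp flip: power_add)
        also have "\<dots> \<le> q ^ Suc 3905" by (rule scale) simp
        also have "\<dots> \<le> q ^ 4000" by (rule mono) simp
        finally show "2 * real M * real N * q ^ 4 \<le> real n" by (simp add: n(2))
      qed (use q0 in simp)
    qed fact
  next
    case False
    then have N_ge: "q ^ 1900 \<le> real N" by simp
    have "2 \<le> q" using q by simp
    also have "q \<le> q ^ 3998" using mono[of 1 3998] by simp
    finally have S2: "2 \<le> card S" using cS by linarith
    obtain t0 where t0: "t0 \<in> S" "real (card {x * b | x b. x \<in> X t0 \<and> b \<in> B}) \<le> q ^ 4 * real n"
      by (rule small_dilate[OF q D S n0(2) S2])
    have "0 \<notin> X t0" using X_A[OF t0(1), of 0] A_pos[of 0] by blast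
    with t0 have X0: "finite (X t0)" "0 \<notin> X t0" "card (X t0) = N"
      by (simp_all add: finite_X card_X)
    obtain M where M: "M > 0" "q ^ 1240 \<le> real M" "real M \<le> q ^ 1241"
      using between[of 1240] by auto
    show False
    proof (rule contr[of M])
      have "2 * real M \<le> 2 * q ^ 1241" using M by simp
      also have "\<dots> \<le> q ^ Suc 1241" by (rule scale) simp
      also have "\<dots> \<le> q ^ 3998" by (rule mono) simp
      finally show "2 * real M \<le> q ^ 3998" .
      fix C1 C2 assume "cluster C1 C2 B X \<eta> M N n"
      then interpret cluster C1 C2 B X \<eta> M N n .
      show "real M * real N * real n * q ^ 4 \<le> real (card sumset)"
      proof (rule card_sumset_ge_of_large_N[OF q X0 t0(2)])
        have "4 * q ^ 6 \<le> q ^ Suc 6" by (rule scale) simp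
        also have "\<dots> \<le> q ^ 4000" by (rule mono) simp
        finally show "4 * q ^ 6 \<le> real n" by (simp add: n(2))
        show "q ^ 6 \<le> real M" using mono[of 6 1240] M by simp
        have "4 * real n * q ^ 39 = 4 * q ^ 4039" by (simp add: n(2) flip: power_add)
        also have "\<dots> \<le> q ^ Suc 4039" by (rule scale) simp
        also have "\<dots> \<le> q ^ 5040" by (rule mono) simp
        also have "\<dots> = q ^ 1240 * (q ^ 1900) ^ 2" by (simp flip: power_add power_mult)
        also have "\<dots> \<le> real M * real N ^ 2" using M N_ge q0 by (intro mult_mono power_mono) auto
        finally show "4 * real n * q ^ 39 \<le> real M * real N ^ 2" .
        have "2 * real n ^ 2 * q ^ 72 = 2 * q ^ 8072" by (simp add: n(2) flip: power_add power_mult)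
        also have "\<dots> \<le> q ^ Suc 8072" by (rule scale) simp
        also have "\<dots> \<le> q ^ 8180" by (rule mono) simp
        also have "\<dots> = (q ^ 1240) ^ 2 * (q ^ 1900) ^ 3" by (simp flip: power_add power_mult)
        also have "\<dots> \<le> real M ^ 2 * real N ^ 3" using M N_ge q0 by (intro mult_mono power_mono) auto
        finally show "2 * real n ^ 2 * q ^ 72 \<le> real M ^ 2 * real N ^ 3" .
        fix u assume u: "u \<in> quads"
        show "real (card (cross u)) * (real M * q ^ 6) \<le> real N * real n"
        \<comment> \<open>Up to \<open>q^2600\<close> the trivial bound \<open>N^2\<close> suffices,
          as \<open>2600 + 1241 + 6 \<le> 4000\<close>. Beyond it incidences apply, as
          \<open>2 * 1241 + 22 + 1 \<le> 2600\<close> and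
          \<open>3 * 1241 + 29 + 1 \<le> 4000\<close>.\<close>
        proof (cases "real N \<le> q ^ 2600")
          case True
          have "real (card (cross u)) * (real M * q ^ 6) \<le> real (N\<^sup>2) * (real M * q ^ 6)"
            using card_cross_le[OF u] q0 by (intro mult_right_mono of_nat_mono) auto
          also have "\<dots> = real N * (real N * real M * q ^ 6)" by (simp add: power2_eq_square)
          also have "\<dots> \<le> real N * (q ^ 2600 * q ^ 1241 * q ^ 6)"
            using True M q0 by (intro mult_left_mono mult_mono) auto
          also have "\<dots> = real N * q ^ 3847" by (simp flip: power_add)
          also have "\<dots> \<le> real N * q ^ 4000" by (intro mult_left_mono mono) auto
          finally show ?thesis by (simp add: n(2))
        next
          case False
          show ?thesis
          proof (rule card_cross_le_of_large_N[OF q u X0 t0(2)])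
            have "real M * q ^ 7 \<le> q ^ 1241 * q ^ 7" using M q0 by (intro mult_right_mono) auto
            also have "\<dots> = q ^ 1248" by (simp flip: power_add)
            also have "\<dots> \<le> q ^ 4000" by (rule mono) simp
            finally show "real M * q ^ 7 \<le> real n" by (simp add: n(2))
            have "2 * real M ^ 2 * q ^ 22 \<le> 2 * (q ^ 1241) ^ 2 * q ^ 22"
              using M q0 by (intro mult_right_mono mult_left_mono power_mono) auto
            also have "\<dots> = 2 * q ^ 2504" by (simp flip: power_add power_mult)
            also have "\<dots> \<le> q ^ Suc 2504" by (rule scale) simp
            also have "\<dots> \<le> q ^ 2600" by (rule mono) simp
            finally show "2 * real M ^ 2 * q ^ 22 \<le> real N" using False by simp
            have "2 * real M ^ 3 * q ^ 29 \<le> 2 * (q ^ 1241) ^ 3 * q ^ 29"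
              using M q0 by (intro mult_right_mono mult_left_mono power_mono) auto
            also have "\<dots> = 2 * q ^ 3752" by (simp flip: power_add power_mult)
            also have "\<dots> \<le> q ^ Suc 3752" by (rule scale) simp
            also have "\<dots> \<le> q ^ 4000" by (rule mono) simp
            finally show "2 * real M ^ 3 * q ^ 29 \<le> real n" by (simp add: n(2))
          qed
        qed
      qed
    qed fact
  qed
qed

end

section \<open>Pigeonholing the slopes by the number of their points\<close>

text \<open>The points of \<open>A \<times> A\<close> are spread over 4001 scales \<open>q^j\<close>
  of line size. The best scale carries a share of at least \<open>1 / 4001\<close>, which costs one
  factor \<open>q\<close> because \<open>q \<ge> 4001\<close>; rounding line sizes to powers of
  \<open>q\<close> costs the other.\<close>

lemma rich_slopes_exist:
  fixes A :: "real set"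
  assumes fin: "finite A" and pos: "\<And>a. a \<in> A \<Longrightarrow> a > 0"
    and q: "q \<ge> 4001" and n: "real (card A) = q ^ 4000"
  obtains S :: "real set" and X :: "real \<Rightarrow> real set" and N :: nat
    where "finite S" "N > 0" "N \<le> card A"
      "\<And>s. s \<in> S \<Longrightarrow> X s \<subseteq> {a \<in> A. s * a \<in> A} \<and> card (X s) = N"
      "(real (card A))\<^sup>2 \<le> real (card S) * real N * q\<^sup>2"
proof -
  define T where "T = (\<lambda>(x, y). y / x) ` (A \<times> A)"
  define F where "F s = {a \<in> A. s * a \<in> A}" for s
  \<comment> \<open>Nested level sets in place of disjoint bands: a slope may be counted at several
    scales, which is harmless when bounding \<open>|A|^2\<close> from above.\<close>
  define S where "S j = {s \<in> T. q ^ j \<le> real (card (F s))}" for j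
  have q1: "q \<ge> 1" and q0: "q > 0" using q by auto
  have finT: "finite T" using fin by (simp add: T_def)
  have finF: "finite (F s)" for s using fin by (simp add: F_def)
  have finS: "finite (S j)" for j using finT by (simp add: S_def)
  have "card (A \<times> A) = card (Sigma T F)"
  proof (rule bij_betw_same_card[of "\<lambda>(x, y). (y / x, x)"], rule bij_betw_imageI)
    show "inj_on (\<lambda>(x, y). (y / x, x)) (A \<times> A)"
      using pos by (fastforce simp: inj_on_def)
    show "(\<lambda>(x, y). (y / x, x)) ` (A \<times> A) = Sigma T F"
    proof (rule set_eqI, rule iffI)
      fix u assume "u \<in> (\<lambda>(x, y). (y / x, x)) ` (A \<times> A)"
      then obtain x y where "u = (y / x, x)" "x \<in> A" "y \<in> A" by auto
      with pos[of x] show "u \<in> Sigma T F" by (auto simp: T_def F_def)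
    next
      fix u assume "u \<in> Sigma T F"
      then obtain s a where u: "u = (s, a)" "a \<in> A" "s * a \<in> A" by (auto simp: F_def)
      with pos[of a] have "u = (s * a / a, a)" by simp
      with u show "u \<in> (\<lambda>(x, y). (y / x, x)) ` (A \<times> A)" by (intro image_eqI[of _ _ "(a, s * a)"]) auto
    qed
  qed
  then have total: "(real (card A))\<^sup>2 = (\<Sum>s\<in>T. real (card (F s)))"
    using finT finF by (simp add: card_cartesian_product power2_eq_square flip: of_nat_mult)
  have F_le: "real (card (F s)) \<le> (\<Sum>j\<le>4000. if s \<in> S j then q ^ Suc j else 0)" if s: "s \<in> T" for s
  proof -
    define J where "J = {j. j \<le> 4000 \<and> q ^ j \<le> real (card (F s))}"
    obtain x y where xy: "x \<in> A" "y \<in> A" "s = y / x" using s by (auto simp: T_def)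
    have "x \<in> F s" using xy pos[of x] by (simp add: F_def)
    then have "card (F s) > 0" using finF card_gt_0_iff by blast
    then have "0 \<in> J" by (simp add: J_def)
    have finJ: "finite J" by (simp add: J_def)
    define j where "j = Max J"
    have "j \<in> J" unfolding j_def using finJ \<open>0 \<in> J\<close> by (intro Max_in) auto
    then have j: "j \<le> 4000" "q ^ j \<le> real (card (F s))" by (auto simp: J_def)
    have "real (card (F s)) \<le> q ^ Suc j"
    proof (cases "j = 4000")
      case True
      have "card (F s) \<le> card A" using fin by (intro card_mono) (auto simp: F_def)
      then have "real (card (F s)) \<le> q ^ 4000" using n by simp
      also have "\<dots> \<le> q ^ Suc j" using q1 True by (intro power_increasing) auto
      finally show ?thesis .
    next
      case False
      have "Suc j \<notin> J" using Max_ge[OF finJ, of "Suc j"] by (auto simp: j_def)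
      with False j show ?thesis by (simp add: J_def)
    qed
    also have "\<dots> = (if s \<in> S j then q ^ Suc j else 0)" using s j by (simp add: S_def)
    also have "\<dots> \<le> (\<Sum>j\<le>4000. if s \<in> S j then q ^ Suc j else 0)"
      using j q0 by (intro member_le_sum) auto
    finally show ?thesis .
  qed
  have "(real (card A))\<^sup>2 \<le> (\<Sum>s\<in>T. \<Sum>j\<le>4000. if s \<in> S j then q ^ Suc j else 0)"
    unfolding total by (intro sum_mono F_le)
  also have "\<dots> = (\<Sum>j\<le>4000. \<Sum>s\<in>T. if s \<in> S j then q ^ Suc j else 0)" by (rule sum.swap)
  also have "\<dots> = (\<Sum>j\<le>4000. real (card (S j)) * q ^ Suc j)"
  proof (rule sum.cong[OF refl])
    fix j
    have "T \<inter> {s. s \<in> S j} = S j" by (auto simp: S_def)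
    then show "(\<Sum>s\<in>T. if s \<in> S j then q ^ Suc j else 0) = real (card (S j)) * q ^ Suc j"
      using finT by (simp add: sum.If_cases)
  qed
  finally have sum: "(real (card A))\<^sup>2 \<le> (\<Sum>j\<le>4000. real (card (S j)) * q ^ Suc j)" .
  have "\<exists>j\<le>4000. (real (card A))\<^sup>2 \<le> real (card (S j)) * q ^ Suc j * 4001"
  proof (rule ccontr)
    assume no: "\<not> ?thesis"
    have "(\<Sum>j\<le>(4000::nat). real (card (S j)) * q ^ Suc j) < (\<Sum>j\<le>(4000::nat). (real (card A))\<^sup>2 / 4001)"
    proof (intro sum_strict_mono)
      fix j :: nat assume "j \<in> {..4000}"
      with no have "real (card (S j)) * q ^ Suc j * 4001 < (real (card A))\<^sup>2"
        by (meson atMost_iff not_less)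
      then show "real (card (S j)) * q ^ Suc j < (real (card A))\<^sup>2 / 4001" by linarith
    qed auto
    with sum show False by simp
  qed
  then obtain j where j: "(real (card A))\<^sup>2 \<le> real (card (S j)) * q ^ Suc j * 4001" by blast
  \<comment> \<open>Rounding up gives \<open>q^j \<le> N\<close>, and \<open>N\<close> still does
    not exceed any integer \<open>card (F s) \<ge> q^j\<close>, so each line can be trimmed to
    \<open>N\<close> points.\<close>
  define N where "N = nat \<lceil>q ^ j\<rceil>"
  have "q ^ j \<ge> 1" using q1 by simp
  then have N: "q ^ j \<le> real N" "N > 0" by (auto simp: N_def real_nat_ceiling_ge)
  have N_F: "N \<le> card (F s)" if "s \<in> S j" for s
    using that by (simp add: S_def N_def nat_le_iff ceiling_le_iff)
  have "S j \<noteq> {}"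
  proof
    assume "S j = {}"
    with j n q0 show False by simp
  qed
  then obtain s0 where "s0 \<in> S j" by blast
  then have "N \<le> card A"
    using N_F[of s0] card_mono[of A "F s0"] fin by (force simp: F_def)
  moreover have "\<exists>Y. Y \<subseteq> F s \<and> card Y = N" if "s \<in> S j" for s
    using obtain_subset_with_card_n[OF N_F[OF that]] by metis
  then obtain X where "\<And>s. s \<in> S j \<Longrightarrow> X s \<subseteq> F s \<and> card (X s) = N" by metis
  moreover have "(real (card A))\<^sup>2 \<le> real (card (S j)) * real N * q\<^sup>2"
  proof -
    have "real (card (S j)) * q ^ Suc j * 4001 = real (card (S j)) * q ^ j * (q * 4001)" by simp
    also have "\<dots> \<le> real (card (S j)) * real N * (q * q)"
      using N q q0 by (intro mult_mono mult_left_mono) auto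
    finally show ?thesis using j by (simp add: power2_eq_square)
  qed
  ultimately show thesis using that[of "S j" N X] finS N by (simp add: F_def)
qed

section \<open>Choice of the constants\<close>

lemma le_powr_inverse:
  fixes c :: real
  assumes "c > 0" "k > 0" "nat \<lceil>c powr k\<rceil> \<le> n"
  shows "c \<le> real n powr (1 / k)"
proof -
  have "c = (c powr k) powr (1 / k)" using assms by (simp add: powr_powr)
  also have "\<dots> \<le> real n powr (1 / k)"
    using assms by (intro powr_mono2) (auto simp: nat_le_iff ceiling_le_iff)
  finally show ?thesis .
qed

theorem theorem11:
  shows "\<exists>(n0::nat) (c::real) (C::real). c > 0 \<and> C > 0 \<and>
    (\<forall>(A::real set) (B::real set).
      finite A \<longrightarrow> finite B \<longrightarrow> (\<forall>a\<in>A. a > 0) \<longrightarrow> (\<forall>b\<in>B. b > 0) \<longrightarrow>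
      card A = card B \<longrightarrow> card A \<ge> n0 \<longrightarrow>
      real (card {a * b + a' | a a' b. a \<in> A \<and> a' \<in> A \<and> b \<in> B})
        \<ge> C * real (card A) powr (3 / 2 + c))"
proof (intro exI conjI allI impI)
  \<comment> \<open>\<open>|D|^2 \<ge> q n^3\<close> with \<open>q = n^(1/4000)\<close> gives the
    exponent \<open>3/2 + 1/8000\<close>; the threshold on \<open>card A\<close> below ensures
    \<open>q \<ge> 4001\<close>.\<close>
  show "(1 / 8000 :: real) > 0" "(1 :: real) > 0" by auto
  fix A B :: "real set"
  assume fin: "finite A" "finite B" and pos: "\<forall>a\<in>A. a > 0" "\<forall>b\<in>B. b > 0"
    and card: "card A = card B" and large: "card A \<ge> nat \<lceil>(4001 :: real) powr 4000\<rceil>"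
  define n where "n = card A"
  define q where "q = real n powr (1 / 4000)"
  have q: "q \<ge> 4001"
    unfolding q_def n_def by (rule le_powr_inverse[OF _ _ large]) auto
  then have n0: "real n > 0" by (cases "n = 0") (auto simp: q_def)
  have "q ^ 4000 = q powr real 4000" by (rule powr_realpow[symmetric]) (use q in linarith)
  also have "\<dots> = real n powr (1 / 4000 * real 4000)" by (simp only: q_def powr_powr)
  also have "(1 / 4000 * real 4000) = 1" by simp
  also have "real n powr 1 = real n" using n0 by simp
  finally have nq: "real n = q ^ 4000" by (rule sym)
  obtain S :: "real set" and X N where S: "finite S" "N > 0" "N \<le> card A"
      "\<And>s. s \<in> S \<Longrightarrow> X s \<subseteq> {a \<in> A. s * a \<in> A} \<and> card (X s) = N"
      "(real (card A))\<^sup>2 \<le> real (card S) * real N * q\<^sup>2"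
    by (rule rich_slopes_exist[OF fin(1) _ q nq[unfolded n_def]]) (use pos(1) in blast)+
  interpret rich_slopes A B S X N
  proof
    show "B \<noteq> {}" using n0 card by (auto simp: n_def)
    show "a \<in> A" "s * a \<in> A" if "s \<in> S" "a \<in> X s" for s a using S(4)[OF that(1)] that(2) by auto
  qed (use fin pos S in auto)
  have "q * real n ^ 3 \<le> (real (card D))\<^sup>2"
  proof (rule card_D_squared_ge)
    show "q \<ge> 100" using q by linarith
    show "n = card B" using card by (simp only: n_def)
    show "N \<le> n" "(real n)\<^sup>2 \<le> real (card S) * real N * q\<^sup>2" using S by (simp_all only: n_def)
  qed (rule nq)
  also have "q * real n ^ 3 = real n powr (1 / 4000) * real n powr 3"
    using n0 by (simp only: q_def powr_numeral)
  also have "\<dots> = (real n powr (3 / 2 + 1 / 8000))\<^sup>2"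
    by (simp only: power2_eq_square powr_add[symmetric]) simp
  finally have "real n powr (3 / 2 + 1 / 8000) \<le> real (card D)" by (rule power2_le_imp_le) simp
  then show "1 * real (card A) powr (3 / 2 + 1 / 8000)
      \<le> real (card {a * b + a' | a a' b. a \<in> A \<and> a' \<in> A \<and> b \<in> B})"
    by (simp only: n_def D_def mult_1)
qed

end
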